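(* Assume Martin's Axiom $\mathsf{MA}$. Then there exist a compact non-separable space $K$ supporting a measure and a continuous mapping $f\colon K\to 2^\omega$ such that for every $t\in 2^\omega$ the fiber $f^{-1}[\{t\}]$ is homeomorphic to an ordinal number (with the order topology); consequently, there is no continuous surjection from $K$ onto $[0,1]^{\omega_1}$. Moreover, $K$ can be taken (the same $K$) to have countable $\pi$-character.
   Context: $\mathsf{MA}$ is the statement: for every ccc partial order $\mathbb{P}$ and every family $\mathcal{D}$ of fewer than $\mathfrak{c}=2^{\aleph_0}$ dense subsets of $\mathbb{P}$ there is a filter in $\mathbb{P}$ meeting every member of $\mathcal{D}$. Compact spaces are Hausdorff. A measure on a topological space is a finite Borel measure that is Radon, i.e. inner regular with respect to compact sets. A space $K$ supports a measure $\mu$ if $\mu(U)>0$ for every nonempty open $U\subseteq K$ (that is, $\mu$ is strictly positive on $K$); $K$ supports a measure if it supports some measure. For $x\in K$, a family $\mathcal{P}$ of nonempty open sets is a $\pi$-base at $x$ if for every open $V\ni x$ there is $U\in\mathcal{P}$ with $U\subseteq V$; $\pi(x,K)$ is the least cardinality of a $\pi$-base at $x$, and the $\pi$-character of $K$ is $\pi\chi(K)=\sup\{\pi(x,K)\colon x\in K\}$. Countable $\pi$-character means that every $x\in K$ has a countable $\pi$-base. An empty fiber is regarded as the ordinal $0$. *)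

theory Defs
  imports "HOL-Analysis.Analysis" "HOL-Library.Equipollence"
begin

subsection \<open>Martin's Axiom\<close>

text \<open>
  A partial order is a carrier \<^term>\<open>P\<close> with a relation \<^term>\<open>r\<close> satisfying
  \<^term>\<open>partial_order_on P r\<close>; \<^term>\<open>(p, q) \<in> r\<close> is read \<open>p \<le> q\<close>, i.e. \<open>p\<close> is the stronger condition.
\<close>

definition compatible_in :: "'a set \<Rightarrow> 'a rel \<Rightarrow> 'a \<Rightarrow> 'a \<Rightarrow> bool" where
  "compatible_in P r p q \<longleftrightarrow> (\<exists>s\<in>P. (s, p) \<in> r \<and> (s, q) \<in> r)"

definition ccc_order :: "'a set \<Rightarrow> 'a rel \<Rightarrow> bool" where
  "ccc_order P r \<longleftrightarrow>
     (\<forall>A\<subseteq>P. (\<forall>p\<in>A. \<forall>q\<in>A. p \<noteq> q \<longrightarrow> \<not> compatible_in P r p q) \<longrightarrow> countable A)"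

definition dense_in_order :: "'a set \<Rightarrow> 'a rel \<Rightarrow> 'a set \<Rightarrow> bool" where
  "dense_in_order P r D \<longleftrightarrow> D \<subseteq> P \<and> (\<forall>p\<in>P. \<exists>d\<in>D. (d, p) \<in> r)"

definition filter_in_order :: "'a set \<Rightarrow> 'a rel \<Rightarrow> 'a set \<Rightarrow> bool" where
  "filter_in_order P r F \<longleftrightarrow>
     F \<subseteq> P \<and> F \<noteq> {} \<and>
     (\<forall>p\<in>F. \<forall>q\<in>P. (p, q) \<in> r \<longrightarrow> q \<in> F) \<and>
     (\<forall>p\<in>F. \<forall>q\<in>F. \<exists>s\<in>F. (s, p) \<in> r \<and> (s, q) \<in> r)"

text \<open>The instance of Martin's Axiom for one (nonempty) partial order.\<close>

definition MA_instance :: "'a set \<Rightarrow> 'a rel \<Rightarrow> bool" where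
  "MA_instance P r \<longleftrightarrow>
     (partial_order_on P r \<and> P \<noteq> {} \<and> ccc_order P r \<longrightarrow>
      (\<forall>\<D>. \<D> \<prec> (UNIV :: (nat \<Rightarrow> bool) set) \<and> (\<forall>D\<in>\<D>. dense_in_order P r D) \<longrightarrow>
           (\<exists>F. filter_in_order P r F \<and> (\<forall>D\<in>\<D>. F \<inter> D \<noteq> {}))))"

text \<open>
  HOL cannot quantify over the carrier type, so the axiom is stated for orders whose carrier
  consists of elements of \<open>2\<^sup>\<omega>\<close>. Nothing is lost: the theorem \<open>MA_any_carrier\<close> below derives from
  it the instances for all orders over all types.
\<close>

definition MA :: bool where
  "MA \<longleftrightarrow> (\<forall>(P :: (nat \<Rightarrow> bool) set) r. MA_instance P r)"

lemma lesspoll_continuum_closure: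
  fixes com :: "'a \<Rightarrow> 'a \<Rightarrow> 'a" and den :: "'b \<Rightarrow> 'a \<Rightarrow> 'a"
  assumes D: "\<D> \<prec> (UNIV :: (nat \<Rightarrow> bool) set)"
  obtains Q where "p0 \<in> Q" "\<And>x y. x \<in> Q \<Longrightarrow> y \<in> Q \<Longrightarrow> com x y \<in> Q"
    "\<And>d x. d \<in> \<D> \<Longrightarrow> x \<in> Q \<Longrightarrow> den d x \<in> Q" "Q \<lesssim> (UNIV :: (nat \<Rightarrow> bool) set)"
    "Q \<subseteq> \<Inter>{S. p0 \<in> S \<and> (\<forall>x\<in>S. \<forall>y\<in>S. com x y \<in> S) \<and> (\<forall>d\<in>\<D>. \<forall>x\<in>S. den d x \<in> S)}"
proof -
  let ?c = "UNIV :: (nat \<Rightarrow> bool) set"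
  have natc: "(UNIV :: nat set) \<lesssim> ?c"
  proof -
    have "inj (\<lambda>n m::nat. n = m)" by (auto simp: inj_def fun_eq_iff)
    then show ?thesis by (auto simp: lepoll_def)
  qed
  then have infc: "infinite ?c" by (simp add: infinite_le_lepoll)
  define step where "step S = S \<union> (\<Union>d\<in>\<D>. den d ` S) \<union> (\<lambda>(x,y). com x y) ` (S \<times> S)" for S
  define q where "q n = (step ^^ n) {p0}" for n
  have q0: "q 0 = {p0}" and qS: "q (Suc n) = step (q n)" for n by (auto simp: q_def)
  have un: "(\<Union>i\<in>I. A i) \<lesssim> ?c" if "I \<lesssim> ?c" "\<And>i. i \<in> I \<Longrightarrow> A i \<lesssim> ?c" for I :: "'i set" and A :: "'i \<Rightarrow> 'a set"
  proof -
    have "ordLeq3 (card_of I) (card_of ?c)" "\<forall>i\<in>I. ordLeq3 (card_of (A i)) (card_of ?c)"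
      using that by (auto simp: lepoll_def card_of_ordLeq[symmetric])
    from card_of_UNION_ordLeq_infinite[OF infc this]
    show ?thesis by (auto simp: lepoll_def card_of_ordLeq[symmetric])
  qed
  have un2: "A \<union> B \<lesssim> ?c" if "A \<lesssim> ?c" "B \<lesssim> ?c" for A B :: "'a set"
  proof -
    have "(\<Union>i\<in>{True,False}. if i then A else B) \<lesssim> ?c" (is "?U \<lesssim> _")
      using that by (intro un) (auto intro: finite_lepoll_infinite[OF infc])
    moreover have "?U = A \<union> B" by auto
    ultimately show ?thesis by simp
  qed
  have pr: "S \<times> S \<lesssim> ?c" if "S \<lesssim> ?c" for S :: "'a set"
  proof -
    have "S \<times> S \<lesssim> ?c \<times> ?c" using that by (intro times_lepoll_mono)
    also have "?c \<times> ?c \<approx> ?c"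
      using card_of_Times_same_infinite[OF infc] by (simp add: eqpoll_iff_card_of_ordIso)
    finally show ?thesis .
  qed
  have img: "f ` S \<lesssim> ?c" if "S \<lesssim> ?c" for f :: "'z \<Rightarrow> 'a" and S
    using that image_lepoll lepoll_trans by blast
  have qle: "q n \<lesssim> ?c" for n
  proof (induction n)
    case 0 show ?case unfolding q0 by (rule finite_lepoll_infinite[OF infc]) simp
  next
    case (Suc n)
    then show ?case unfolding qS step_def
      by (intro un2 un img pr lesspoll_imp_lepoll[OF D])
  qed
  define Q where "Q = (\<Union>n. q n)"
  have mono: "q n \<subseteq> q (n + k)" for n k
    by (induction k) (auto simp: qS step_def)
  show thesis
  proof (rule that[of Q])
    show "p0 \<in> Q" using q0 unfolding Q_def by blast
    show "com x y \<in> Q" if xy: "x \<in> Q" "y \<in> Q" for x y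
    proof -
      from xy obtain n m where "x \<in> q n" "y \<in> q m" by (auto simp: Q_def)
      then have "x \<in> q (n + m)" "y \<in> q (n + m)" using mono[of n m] mono[of m n] by (auto simp: add.commute)
      then have "com x y \<in> q (Suc (n + m))" by (force simp: qS step_def)
      then show ?thesis unfolding Q_def by blast
    qed
    show "den d x \<in> Q" if dx: "d \<in> \<D>" "x \<in> Q" for d x
    proof -
      from dx obtain n where "x \<in> q n" by (auto simp: Q_def)
      then have "den d x \<in> q (Suc n)" using dx by (force simp: qS step_def)
      then show ?thesis unfolding Q_def by blast
    qed
    show "Q \<lesssim> ?c" unfolding Q_def by (intro un qle natc)
    show "Q \<subseteq> \<Inter>{S. p0 \<in> S \<and> (\<forall>x\<in>S. \<forall>y\<in>S. com x y \<in> S) \<and> (\<forall>d\<in>\<D>. \<forall>x\<in>S. den d x \<in> S)}"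
    proof -
      have "q n \<subseteq> S" if "p0 \<in> S" "\<forall>x\<in>S. \<forall>y\<in>S. com x y \<in> S" "\<forall>d\<in>\<D>. \<forall>x\<in>S. den d x \<in> S" for n S
        using that by (induction n) (auto simp: q0 qS step_def subset_iff)
      then show ?thesis unfolding Q_def by blast
    qed
  qed
qed

theorem MA_any_carrier:
  fixes P :: "'a set"
  assumes MA shows "MA_instance P r"
  unfolding MA_instance_def
proof (intro impI allI, elim conjE)
  fix \<D> assume po: "partial_order_on P r" and ne: "P \<noteq> {}" and ccc: "ccc_order P r"
    and less: "\<D> \<prec> (UNIV :: (nat \<Rightarrow> bool) set)" and dense: "\<forall>D\<in>\<D>. dense_in_order P r D"
  from po have rP: "r \<subseteq> P \<times> P" and refl: "\<And>x. x \<in> P \<Longrightarrow> (x, x) \<in> r"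
    and tr: "\<And>x y z. (x, y) \<in> r \<Longrightarrow> (y, z) \<in> r \<Longrightarrow> (x, z) \<in> r"
    and asym: "\<And>x y. (x, y) \<in> r \<Longrightarrow> (y, x) \<in> r \<Longrightarrow> x = y"
    by (auto simp: partial_order_on_def preorder_on_def refl_on_def antisym_def elim: transE)
  obtain p0 where p0: "p0 \<in> P" using ne by blast
  define com where "com x y = (if compatible_in P r x y then SOME s. s \<in> P \<and> (s, x) \<in> r \<and> (s, y) \<in> r else p0)" for x y
  define den where "den D x = (SOME d. d \<in> D \<and> (d, x) \<in> r)" for D x
  have com: "com x y \<in> P \<and> (com x y, x) \<in> r \<and> (com x y, y) \<in> r" if "compatible_in P r x y" for x y
    using that someI_ex[of "\<lambda>s. s \<in> P \<and> (s, x) \<in> r \<and> (s, y) \<in> r"]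
    by (auto simp: compatible_in_def com_def)
  have den: "den D x \<in> D \<and> (den D x, x) \<in> r" if "D \<in> \<D>" "x \<in> P" for D x
  proof -
    have "\<exists>d. d \<in> D \<and> (d, x) \<in> r"
    proof -
      have "dense_in_order P r D" using dense that(1) by (rule bspec)
      then have "\<forall>p\<in>P. \<exists>d\<in>D. (d, p) \<in> r" unfolding dense_in_order_def by (rule conjunct2)
      then have "\<exists>d\<in>D. (d, x) \<in> r" using that(2) by (rule bspec)
      then show ?thesis by (elim bexE) (intro exI conjI)
    qed
    then show ?thesis unfolding den_def by (rule someI_ex)
  qed
  obtain Q where Q: "p0 \<in> Q" "\<And>x y. x \<in> Q \<Longrightarrow> y \<in> Q \<Longrightarrow> com x y \<in> Q"
    "\<And>d x. d \<in> \<D> \<Longrightarrow> x \<in> Q \<Longrightarrow> den d x \<in> Q" "Q \<lesssim> (UNIV :: (nat \<Rightarrow> bool) set)"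
    "Q \<subseteq> \<Inter>{S. p0 \<in> S \<and> (\<forall>x\<in>S. \<forall>y\<in>S. com x y \<in> S) \<and> (\<forall>d\<in>\<D>. \<forall>x\<in>S. den d x \<in> S)}"
    by (rule lesspoll_continuum_closure[OF less, of p0 com den]) (rule that; assumption)
  have "com x y \<in> P" for x y using com p0 by (cases "compatible_in P r x y") (auto simp: com_def)
  moreover have "\<forall>D\<in>\<D>. \<forall>x\<in>P. den D x \<in> P" using den rP by blast
  ultimately have QP: "Q \<subseteq> P" using Q(5) p0 by blast
  obtain e :: "'a \<Rightarrow> nat \<Rightarrow> bool" where e: "inj_on e Q" using Q(4) by (auto simp: lepoll_def)
  define P' where "P' = e ` Q"
  define r' where "r' = {(e x, e y) | x y. x \<in> Q \<and> y \<in> Q \<and> (x, y) \<in> r}"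
  have r'[simp]: "(e x, e y) \<in> r' \<longleftrightarrow> (x, y) \<in> r" if "x \<in> Q" "y \<in> Q" for x y
    using that e by (auto simp: r'_def inj_on_def)
  have r'P: "r' \<subseteq> P' \<times> P'" by (auto simp: r'_def P'_def)
  have po': "partial_order_on P' r'"
    unfolding partial_order_on_def preorder_on_def
  proof (intro conjI r'P)
    show "refl_on P' r'" using QP refl by (auto simp: refl_on_def P'_def)
    show "trans r'"
    proof (rule transI)
      fix a b c assume ab: "(a, b) \<in> r'" and bc: "(b, c) \<in> r'"
      then obtain x y z where "x \<in> Q" "y \<in> Q" "z \<in> Q" "a = e x" "b = e y" "c = e z"
        using r'P unfolding P'_def by blast
      then show "(a, c) \<in> r'" using ab bc tr by simp
    qed
    show "antisym r'"
    proof (rule antisymI)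
      fix a b assume ab: "(a, b) \<in> r'" and ba: "(b, a) \<in> r'"
      then obtain x y where "x \<in> Q" "y \<in> Q" "a = e x" "b = e y"
        using r'P unfolding P'_def by blast
      then show "a = b" using ab ba asym[of x y] by simp
    qed
  qed
  have ccc': "ccc_order P' r'"
    unfolding ccc_order_def
  proof (intro allI impI)
    fix A assume A: "A \<subseteq> P'" and anti: "\<forall>p\<in>A. \<forall>q\<in>A. p \<noteq> q \<longrightarrow> \<not> compatible_in P' r' p q"
    obtain B where B: "B \<subseteq> Q" "A = e ` B" using A unfolding P'_def by (meson subset_imageE)
    have "\<not> compatible_in P r x y" if xy: "x \<in> B" "y \<in> B" "x \<noteq> y" for x y
    proof
      assume "compatible_in P r x y"
      note c = com[OF this]
      have xyQ: "x \<in> Q" "y \<in> Q" using xy B by auto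
      then have "com x y \<in> Q" by (rule Q(2))
      then have "compatible_in P' r' (e x) (e y)"
        using c xyQ unfolding compatible_in_def P'_def by auto
      moreover have "e x \<noteq> e y" using e xy xyQ by (auto simp: inj_on_def)
      ultimately show False using anti xy B by blast
    qed
    then have "countable B" using ccc B QP by (auto simp: ccc_order_def)
    then show "countable A" using B by simp
  qed
  let ?T = "\<lambda>D. e ` (D \<inter> Q)"
  have "?T ` \<D> \<prec> (UNIV :: (nat \<Rightarrow> bool) set)" using less image_lepoll lesspoll_trans1 by blast
  moreover have "\<forall>D\<in>?T ` \<D>. dense_in_order P' r' D"
  proof
    fix D' assume "D' \<in> ?T ` \<D>"
    then obtain D where D: "D \<in> \<D>" "D' = ?T D" by blast
    have "\<exists>d\<in>D'. (d, e x) \<in> r'" if "x \<in> Q" for x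
    proof -
      have "den D x \<in> Q" "den D x \<in> D" "(den D x, x) \<in> r" using Q(3) den D that QP by auto
      then show ?thesis using D that by auto
    qed
    then show "dense_in_order P' r' D'" using D by (auto simp: dense_in_order_def P'_def)
  qed
  moreover have "P' \<noteq> {}" using Q(1) by (auto simp: P'_def)
  moreover have "MA_instance P' r'" using \<open>MA\<close> by (simp add: MA_def)
  ultimately obtain F' where F': "filter_in_order P' r' F'" "\<forall>D\<in>?T ` \<D>. F' \<inter> D \<noteq> {}"
    using po' ccc' unfolding MA_instance_def by blast
  define F where "F = {p \<in> P. \<exists>x\<in>Q. e x \<in> F' \<and> (x, p) \<in> r}"
  have F'P: "F' \<subseteq> P'" using F' by (simp add: filter_in_order_def)
  have inF: "x \<in> F" if "x \<in> Q" "e x \<in> F'" for x using that refl QP by (auto simp: F_def)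
  have "filter_in_order P r F"
    unfolding filter_in_order_def
  proof (intro conjI ballI impI)
    show "F \<subseteq> P" by (auto simp: F_def)
    have "F' \<noteq> {}" using F' by (simp add: filter_in_order_def)
    then obtain x where "x \<in> Q" "e x \<in> F'" using F'P unfolding P'_def by blast
    then show "F \<noteq> {}" using inF by blast
  next
    fix p q assume "p \<in> F" "q \<in> P" "(p, q) \<in> r"
    then show "q \<in> F" using tr unfolding F_def by blast
  next
    fix p q assume "p \<in> F" "q \<in> F"
    then obtain x y where xy: "x \<in> Q" "e x \<in> F'" "(x, p) \<in> r" "y \<in> Q" "e y \<in> F'" "(y, q) \<in> r"
      by (auto simp: F_def)
    then obtain s' where s': "s' \<in> F'" "(s', e x) \<in> r'" "(s', e y) \<in> r'"
      using F' unfolding filter_in_order_def by blast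
    then obtain s where s: "s \<in> Q" "s' = e s" using F'P by (auto simp: P'_def)
    then have "(s, x) \<in> r" "(s, y) \<in> r" "s \<in> F" using s' xy inF by auto
    then show "\<exists>s\<in>F. (s, p) \<in> r \<and> (s, q) \<in> r" using tr xy by blast
  qed
  moreover have "\<forall>D\<in>\<D>. F \<inter> D \<noteq> {}"
  proof
    fix D assume "D \<in> \<D>"
    then have "F' \<inter> ?T D \<noteq> {}" using F' by blast
    then obtain x where "x \<in> D" "x \<in> Q" "e x \<in> F'" by blast
    then show "F \<inter> D \<noteq> {}" using inF by blast
  qed
  ultimately show "\<exists>F. filter_in_order P r F \<and> (\<forall>D\<in>\<D>. F \<inter> D \<noteq> {})" by blast
qed


subsection \<open>Measures on topological spaces\<close>

text \<open>
  In a Hausdorff space every compact set is closed, so the requirement \<^term>\<open>C \<in> sets M\<close> in the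
  supremum is then automatic.
\<close>

definition radon_measure_on :: "'a topology \<Rightarrow> 'a measure \<Rightarrow> bool" where
  "radon_measure_on X M \<longleftrightarrow>
     space M = topspace X \<and>
     sets M = sigma_sets (topspace X) {U. openin X U} \<and>
     finite_measure M \<and>
     (\<forall>B\<in>sets M. emeasure M B = (SUP C\<in>{C \<in> sets M. C \<subseteq> B \<and> compactin X C}. emeasure M C))"

definition supports_measure :: "'a topology \<Rightarrow> bool" where
  "supports_measure X \<longleftrightarrow>
     (\<exists>M. radon_measure_on X M \<and> (\<forall>U. openin X U \<and> U \<noteq> {} \<longrightarrow> emeasure M U > 0))"


subsection \<open>The \<open>\<pi>\<close>-character\<close>

definition pi_base_at :: "'a topology \<Rightarrow> 'a \<Rightarrow> 'a set set \<Rightarrow> bool" where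
  "pi_base_at X x \<P> \<longleftrightarrow>
     (\<forall>U\<in>\<P>. openin X U \<and> U \<noteq> {}) \<and>
     (\<forall>V. openin X V \<and> x \<in> V \<longrightarrow> (\<exists>U\<in>\<P>. U \<subseteq> V))"

definition countable_pi_character :: "'a topology \<Rightarrow> bool" where
  "countable_pi_character X \<longleftrightarrow>
     (\<forall>x\<in>topspace X. \<exists>\<P>. countable \<P> \<and> pi_base_at X x \<P>)"


subsection \<open>Ordinals as topological spaces\<close>

text \<open>
  An ordinal is represented by a (reflexive) well-order \<^term>\<open>r\<close> on \<^term>\<open>Field r\<close>. Its order topology has
  the open rays as a subbase; \<^term>\<open>Field r\<close> itself is listed separately because a one-point
  order has no nonempty open rays. The empty relation represents the ordinal 0.
\<close>

definition order_topology_of :: "'a rel \<Rightarrow> 'a topology" where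
  "order_topology_of r =
     topology_generated_by (insert (Field r) (underS r ` Field r \<union> aboveS r ` Field r))"

text \<open>
  A space homeomorphic to an ordinal is in bijection with it, so the ordinal can be realised by a
  well-order on the point type of the space; \<open>homeomorphic_to_ordinalI\<close> below confirms that
  restricting the type of the well-order loses nothing.
\<close>

definition homeomorphic_to_ordinal :: "'a topology \<Rightarrow> bool" where
  "homeomorphic_to_ordinal X \<longleftrightarrow>
     (\<exists>r :: 'a rel. Well_order r \<and> X homeomorphic_space order_topology_of r)"

lemma topspace_order_topology_of [simp]: "topspace (order_topology_of r) = Field r"
  by (auto simp: order_topology_of_def topology_generated_by_topspace underS_def aboveS_def Field_def)

lemma homeomorphic_map_order_topology_dir_image:
  assumes "inj_on h (Field r)"
  shows "homeomorphic_map (order_topology_of r) (order_topology_of (dir_image r h)) h"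
proof -
  let ?S = "\<lambda>r. insert (Field r) (underS r ` Field r \<union> aboveS r ` Field r)"
  have F: "Field (dir_image r h) = h ` Field r" by (rule dir_image_Field)
  have dir: "(h x, h y) \<in> dir_image r h \<longleftrightarrow> (x, y) \<in> r" if "x \<in> Field r" "y \<in> Field r" for x y
  proof
    assume "(h x, h y) \<in> dir_image r h"
    then obtain a b where "(a, b) \<in> r" "h a = h x" "h b = h y" by (auto simp: dir_image_def)
    moreover then have "a \<in> Field r" "b \<in> Field r" by (auto simp: Field_def)
    ultimately show "(x, y) \<in> r" using assms that by (metis inj_onD)
  qed (auto simp: dir_image_def)
  have dirF: "a \<in> h ` Field r \<and> b \<in> h ` Field r" if "(a, b) \<in> dir_image r h" for a b
    using that by (metis F FieldI1 FieldI2)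
  have u: "underS (dir_image r h) (h a) = h ` underS r a" if a: "a \<in> Field r" for a
  proof (intro set_eqI iffI)
    fix z assume z: "z \<in> underS (dir_image r h) (h a)"
    then have "z \<in> h ` Field r" using dirF by (auto simp: underS_def)
    then obtain b where "b \<in> Field r" "z = h b" by blast
    then show "z \<in> h ` underS r a" using z a dir by (auto simp: underS_def)
  next
    fix z assume "z \<in> h ` underS r a"
    then obtain b where b: "z = h b" "b \<noteq> a" "(b, a) \<in> r" by (auto simp: underS_def)
    then have bF: "b \<in> Field r" by (auto simp: Field_def)
    then have "h b \<noteq> h a" using b a assms by (auto simp: inj_on_def)
    then show "z \<in> underS (dir_image r h) (h a)" using b bF a dir by (auto simp: underS_def)
  qed
  have o: "aboveS (dir_image r h) (h a) = h ` aboveS r a" if a: "a \<in> Field r" for a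
  proof (intro set_eqI iffI)
    fix z assume z: "z \<in> aboveS (dir_image r h) (h a)"
    then have "z \<in> h ` Field r" using dirF by (auto simp: aboveS_def)
    then obtain b where "b \<in> Field r" "z = h b" by blast
    then show "z \<in> h ` aboveS r a" using z a dir by (auto simp: aboveS_def)
  next
    fix z assume "z \<in> h ` aboveS r a"
    then obtain b where b: "z = h b" "b \<noteq> a" "(a, b) \<in> r" by (auto simp: aboveS_def)
    then have bF: "b \<in> Field r" by (auto simp: Field_def)
    then have "h b \<noteq> h a" using b a assms by (auto simp: inj_on_def)
    then show "z \<in> aboveS (dir_image r h) (h a)" using b bF a dir by (auto simp: aboveS_def)
  qed
  have S: "?S (dir_image r h) = (`) h ` ?S r"
    unfolding F image_insert image_Un image_image
    using u o by (auto simp: image_iff)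
  have subF: "T \<subseteq> Field r" if "T \<in> ?S r" for T
    using that by (auto simp: underS_def aboveS_def Field_def)
  let ?g = "inv_into (Field r) h"
  have gh: "?g (h x) = x" if "x \<in> Field r" for x using that assms by simp
  have c1: "continuous_map (order_topology_of r) (order_topology_of (dir_image r h)) h"
    unfolding order_topology_of_def[of "dir_image r h"]
  proof (rule continuous_on_generated_topo)
    fix T assume "T \<in> ?S (dir_image r h)"
    then obtain U where U: "U \<in> ?S r" "T = h ` U" unfolding S by blast
    have "h -` T \<inter> topspace (order_topology_of r) = U"
      using U(2) subF[OF U(1)] assms by (auto simp: inj_on_def)
    then show "openin (order_topology_of r) (h -` T \<inter> topspace (order_topology_of r))"
      using U(1) topology_generated_by_Basis unfolding order_topology_of_def by metis
  next
    show "h ` topspace (order_topology_of r) \<subseteq> \<Union>(?S (dir_image r h))"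
      using F by simp
  qed
  have c2: "continuous_map (order_topology_of (dir_image r h)) (order_topology_of r) ?g"
    unfolding order_topology_of_def[of r]
  proof (rule continuous_on_generated_topo)
    fix U assume U: "U \<in> ?S r"
    have "?g -` U \<inter> topspace (order_topology_of (dir_image r h)) = h ` U"
      using subF[OF U] gh F by (auto simp: image_iff)
    moreover have "h ` U \<in> ?S (dir_image r h)" using U unfolding S by blast
    ultimately show "openin (order_topology_of (dir_image r h))
        (?g -` U \<inter> topspace (order_topology_of (dir_image r h)))"
      using topology_generated_by_Basis unfolding order_topology_of_def by metis
  next
    show "?g ` topspace (order_topology_of (dir_image r h)) \<subseteq> \<Union>(?S r)"
      using F gh by auto
  qed
  have "homeomorphic_maps (order_topology_of r) (order_topology_of (dir_image r h)) h ?g"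
    unfolding homeomorphic_maps_def using c1 c2 F gh by auto
  then show ?thesis by (rule homeomorphic_maps_imp_map)
qed

lemma homeomorphic_to_ordinalI:
  fixes X :: "'a topology" and r :: "'b rel"
  assumes wo: "Well_order r" and X: "X homeomorphic_space order_topology_of r"
  shows "homeomorphic_to_ordinal X"
proof -
  obtain h where h: "homeomorphic_map (order_topology_of r) X h"
    using X homeomorphic_space homeomorphic_space_sym by blast
  then have inj: "inj_on h (Field r)" by (auto simp: homeomorphic_eq_everything_map)
  have "order_topology_of r homeomorphic_space order_topology_of (dir_image r h)"
    using homeomorphic_map_order_topology_dir_image[OF inj] homeomorphic_space by blast
  then have "X homeomorphic_space order_topology_of (dir_image r h)"
    using X homeomorphic_space_trans by blast
  moreover have "Well_order (dir_image r h)" using Well_order_dir_image wo inj by blast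
  ultimately show ?thesis unfolding homeomorphic_to_ordinal_def by blast
qed


subsection \<open>The Cantor space and the Tikhonov cube of weight \<open>\<omega>\<^sub>1\<close>\<close>

definition cantor_space :: "(nat \<Rightarrow> bool) topology" where
  "cantor_space = product_topology (\<lambda>_. discrete_topology UNIV) UNIV"

definition omega1 :: "nat set set" where
  "omega1 = Field (cardSuc natLeq)"

definition tikhonov_cube_omega1 :: "(nat set \<Rightarrow> real) topology" where
  "tikhonov_cube_omega1 = product_topology (\<lambda>_. top_of_set {0..1}) omega1"

end

theory Submission
  imports Defs "HOL-Probability.Infinite_Product_Measure" "HOL-Probability.Probability_Mass_Function"
begin

text \<open>
  Split \<open>\<omega>\<close> into blocks of size \<open>2\<^sup>n\<close> and let \<open>P\<^sub>n\<close> be the uniform distribution on the \<open>n\<close>-th block. Under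
  Martin's Axiom the sets \<open>B\<close> with \<open>\<Sum>n. P\<^sub>n B < \<infinity>\<close> have a cofinal chain \<open>A\<^sub>a\<close>, increasing modulo finite
  and of length \<open>2\<^sup>\<omega>\<close>: fewer than \<open>2\<^sup>\<omega>\<close> such sets have an almost upper bound, by an amoeba-like forcing.
  Let \<open>K\<close> be the Stone space of the algebra of sets of transversals of the blocks generated by
  the sets of all \<open>z\<close> that avoid \<open>i\<close>, respectively \<open>A\<^sub>a - m\<close>. Forgetting the \<open>A\<^sub>a\<close> maps \<open>K\<close> to the space of
  transversals. Over a transversal \<open>t\<close> the only freedom left is which \<open>A\<^sub>a\<close> are almost avoided; these \<open>a\<close> form an
  initial segment, and it is bounded because \<open>t\<close> itself is contained in some \<open>A\<^sub>a\<close>, so the fiber is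
  an ordinal. A countable set of points has traces that are almost contained in a single \<open>A\<^sub>a\<close>, and then
  misses the open set of points avoiding \<open>A\<^sub>a - m\<close>. The product of the \<open>P\<^sub>n\<close> is positive on
  every nonempty set of the algebra, since the tails of \<open>\<Sum>n. P\<^sub>n A\<^sub>a\<close> are small.
\<close>

subsection \<open>Almost upper bounds and chains under Martin's Axiom\<close>

lemma emeasure_tail_less:
  fixes M :: "nat measure"
  assumes sets: "sets M = UNIV" and fin: "emeasure M A < \<infinity>" and e: "0 < e"
  shows "\<exists>n\<ge>k. emeasure M (A - {..<n}) < e"
proof -
  have sub: "emeasure M (A - {..<n}) \<le> emeasure M A" for n
    using sets by (intro emeasure_mono) auto
  have "(\<lambda>n. emeasure M (A - {..<n})) \<longlonglongrightarrow> emeasure M (\<Inter>n. A - {..<n})"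
  proof (rule Lim_emeasure_decseq)
    show "range (\<lambda>n. A - {..<n}) \<subseteq> sets M" using sets by simp
    show "decseq (\<lambda>n. A - {..<n})" by (force simp: decseq_def)
    show "emeasure M (A - {..<n}) \<noteq> \<infinity>" for n using sub[of n] fin by (auto simp: top_unique)
  qed
  also have "(\<Inter>n. A - {..<n}) = {}" by auto
  finally have "(\<lambda>n. emeasure M (A - {..<n})) \<longlonglongrightarrow> 0" by (simp only: emeasure_empty)
  then have "\<forall>\<^sub>F n in sequentially. emeasure M (A - {..<n}) < e"
    using e by (rule order_tendstoD(2))
  then obtain N where "\<forall>n\<ge>N. emeasure M (A - {..<n}) < e" by (auto simp: eventually_sequentially)
  then show ?thesis by (intro exI[of _ "max N k"]) auto
qed

lemma emeasure_Un_less: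
  assumes "sets M = UNIV" "emeasure M A + emeasure M B < c"
  shows "emeasure M (A \<union> B) < c"
  using emeasure_subadditive[of A M B] assms by (auto intro: le_less_trans)

lemma ennreal_add_less_1:
  assumes "(b::ennreal) < 1 - a" "a < 1" shows "a + b < 1"
proof -
  have "a \<noteq> top" using assms(2) by auto
  then have "a + b < a + (1 - a)" using assms(1) by (simp add: ennreal_add_left_cancel_less)
  also have "a + (1 - a) = 1" using assms(2) by (intro add_diff_inverse_ennreal) simp
  finally show ?thesis .
qed

text \<open>A condition \<open>p\<close> promises \<open>snd p \<subseteq> B\<close> with
  \<open>emeasure M (snd p) < 1\<close>, so that the union over a filter has measure at most 1. The
  number \<open>fst p\<close> bounds the part of \<open>A\<close> that \<open>B\<close> may miss
  once a condition in \<open>D A\<close> belongs to the filter.\<close>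

lemma MA_almost_upper_bound:
  fixes M :: "nat measure"
  assumes MA and sets: "sets M = UNIV"
    and small: "\<F> \<prec> (UNIV :: (nat \<Rightarrow> bool) set)"
    and fin: "\<And>A. A \<in> \<F> \<Longrightarrow> emeasure M A < \<infinity>"
  shows "\<exists>B. emeasure M B < \<infinity> \<and> (\<forall>A\<in>\<F>. finite (A - B))"
proof -
  define P where "P = {p :: nat \<times> nat set. emeasure M (snd p) < 1}"
  define r where "r = {(q, p). q \<in> P \<and> p \<in> P \<and> fst p \<le> fst q \<and> snd p \<subseteq> snd q
    \<and> snd p \<inter> {..<fst p} = snd q \<inter> {..<fst p}}"
  have po: "partial_order_on P r"
    unfolding partial_order_on_def preorder_on_def refl_on_def
  proof (intro conjI)
    show "r \<subseteq> P \<times> P" "\<forall>x\<in>P. (x, x) \<in> r" by (auto simp: r_def)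
    show "trans r"
    proof (rule transI)
      fix x y z assume "(x, y) \<in> r" "(y, z) \<in> r"
      moreover from this have "{..<fst z} \<subseteq> {..<fst y}" by (auto simp: r_def)
      ultimately show "(x, z) \<in> r" unfolding r_def by fastforce
    qed
    show "antisym r" by (auto simp: r_def antisym_def prod_eq_iff)
  qed
  have ne: "P \<noteq> {}" by (auto simp: P_def intro!: exI[of _ "{}"])
  have tail: "\<exists>k\<ge>fst p. emeasure M (A - {..<k}) < 1 - emeasure M (snd p)"
    if "p \<in> P" "emeasure M A < \<infinity>" for p A
    using that by (intro emeasure_tail_less sets) (auto simp: P_def intro: diff_gr0_ennreal)
  have finP: "emeasure M (snd p) < \<infinity>" if "p \<in> P" for p
    using that by (auto simp: P_def less_top[symmetric])
  \<comment> \<open>Beyond \<open>k p\<close> the set \<open>snd p\<close> weighs less than the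
    slack \<open>1 - emeasure M (snd p)\<close> that the condition has left.\<close>
  define k where "k p = (SOME k. k \<ge> fst p \<and> emeasure M (snd p - {..<k}) < 1 - emeasure M (snd p))" for p
  have k: "k p \<ge> fst p \<and> emeasure M (snd p - {..<k p}) < 1 - emeasure M (snd p)" if "p \<in> P" for p
    unfolding k_def using tail[OF that finP[OF that]] by (rule someI_ex)
  \<comment> \<open>Conditions with the same value of \<open>h\<close> are compatible, so the order is \<open>\<sigma>\<close>-linked.\<close>
  define h where "h p = (fst p, k p, snd p \<inter> {..<k p})" for p :: "nat \<times> nat set"
  have hD: "fst p = fst q" "k p = k q" "snd p \<inter> {..<k p} = snd q \<inter> {..<k p}" if "h p = h q" for p q
    using that unfolding h_def prod.inject by metis+
  \<comment> \<open>Below the common \<open>k\<close> the two sets agree, so the union adds to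
    \<open>snd q\<close> only the tail of \<open>snd p\<close>. If that is the lighter tail, it fits
    into the slack of \<open>q\<close>; one of the two orders of \<open>p\<close> and
    \<open>q\<close> always applies.\<close>
  have half: "emeasure M (snd p \<union> snd q) < 1"
    if pq: "p \<in> P" "q \<in> P" "h p = h q"
      and le: "emeasure M (snd p - {..<k p}) \<le> emeasure M (snd q - {..<k q})" for p q
  proof -
    note e = hD[OF pq(3)]
    then have "snd p \<union> snd q = snd q \<union> (snd p - {..<k p})" by blast
    moreover have "emeasure M (snd q) + emeasure M (snd p - {..<k p}) < 1"
    proof (rule ennreal_add_less_1)
      show "emeasure M (snd p - {..<k p}) < 1 - emeasure M (snd q)"
        using k[OF pq(2)] le by (blast intro: le_less_trans)
      show "emeasure M (snd q) < 1" using pq(2) by (simp add: P_def)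
    qed
    ultimately show ?thesis using emeasure_Un_less[OF sets] by simp
  qed
  have compat: "compatible_in P r p q" if pq: "p \<in> P" "q \<in> P" "h p = h q" for p q
  proof -
    have "emeasure M (snd p \<union> snd q) < 1"
      using half[OF pq] half[OF pq(2,1) pq(3)[symmetric]] by (metis Un_commute linear)
    then have "(fst p, snd p \<union> snd q) \<in> P" by (simp add: P_def)
    moreover have "snd p \<inter> {..<fst p} = snd q \<inter> {..<fst p}" "fst p = fst q"
    proof -
      have "{..<fst p} = {..<k p} \<inter> {..<fst p}" using k[OF pq(1)] by auto
      then show "snd p \<inter> {..<fst p} = snd q \<inter> {..<fst p}"
        using hD(3)[OF pq(3)] by (metis Int_assoc)
      show "fst p = fst q" using hD(1)[OF pq(3)] .
    qed
    ultimately show ?thesis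
      unfolding compatible_in_def using pq
      by (intro bexI[of _ "(fst p, snd p \<union> snd q)"]) (auto simp: r_def)
  qed
  have ccc: "ccc_order P r"
    unfolding ccc_order_def
  proof (intro allI impI)
    fix C assume C: "C \<subseteq> P" and anti: "\<forall>p\<in>C. \<forall>q\<in>C. p \<noteq> q \<longrightarrow> \<not> compatible_in P r p q"
    have "inj_on h C" using compat anti C unfolding inj_on_def by (meson subsetD)
    moreover have "countable (h ` C)"
    proof (rule countable_subset)
      show "h ` C \<subseteq> UNIV \<times> UNIV \<times> {F. finite F}" by (auto simp: h_def)
      show "countable ((UNIV :: nat set) \<times> (UNIV :: nat set) \<times> {F :: nat set. finite F})"
        by (intro countable_SIGMA countable_Collect_finite) auto
    qed
    ultimately show "countable C" by (rule countable_image_inj_on[rotated])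
  qed
  \<comment> \<open>Density: a far enough tail of \<open>A\<close> fits into the slack, and
    \<open>fst p\<close> is raised to where that tail begins.\<close>
  define D where "D A = {p \<in> P. A - {..<fst p} \<subseteq> snd p}" for A
  have dense: "dense_in_order P r (D A)" if A: "A \<in> \<F>" for A
    unfolding dense_in_order_def
  proof (intro conjI ballI)
    show "D A \<subseteq> P" by (auto simp: D_def)
    fix p assume p: "p \<in> P"
    obtain m where m: "m \<ge> fst p" "emeasure M (A - {..<m}) < 1 - emeasure M (snd p)"
      using tail[OF p fin[OF A]] by blast
    have "emeasure M (snd p \<union> (A - {..<m})) < 1"
      using m p by (intro emeasure_Un_less sets ennreal_add_less_1) (auto simp: P_def)
    then have "(m, snd p \<union> (A - {..<m})) \<in> P" by (simp add: P_def)
    then show "\<exists>d\<in>D A. (d, p) \<in> r"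
      using m(1) p by (intro bexI[of _ "(m, snd p \<union> (A - {..<m}))"]) (auto simp: D_def r_def)
  qed
  have inst: "partial_order_on P r \<and> P \<noteq> {} \<and> ccc_order P r" using po ne ccc by simp
  have "D ` \<F> \<prec> (UNIV :: (nat \<Rightarrow> bool) set)"
    using small image_lepoll lesspoll_trans1 by blast
  then have "D ` \<F> \<prec> (UNIV :: (nat \<Rightarrow> bool) set) \<and> (\<forall>E\<in>D ` \<F>. dense_in_order P r E)"
    using dense by simp
  from MA_any_carrier[OF \<open>MA\<close>, of P r, unfolded MA_instance_def, THEN mp, OF inst, THEN spec, THEN mp, OF this]
  obtain G where G: "filter_in_order P r G" and meets: "\<forall>A\<in>\<F>. G \<inter> D A \<noteq> {}" by auto
  have GP: "G \<subseteq> P" and Gne: "G \<noteq> {}" using G by (auto simp: filter_in_order_def)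
  define B where "B = \<Union>(snd ` G)"
  \<comment> \<open>Since \<open>G\<close> is directed, each finite piece of the union lies in a
    single condition and so weighs less than 1; continuity from below then bounds the whole
    union.\<close>
  have fin_part: "\<exists>p\<in>G. B \<inter> {..<N} \<subseteq> snd p" for N
  proof (induction N)
    case 0 then show ?case using Gne by auto
  next
    case (Suc N)
    then obtain p where p: "p \<in> G" "B \<inter> {..<N} \<subseteq> snd p" by blast
    show ?case
    proof (cases "N \<in> B")
      case True
      then obtain q where q: "q \<in> G" "N \<in> snd q" by (auto simp: B_def)
      obtain s where "s \<in> G" "(s, p) \<in> r" "(s, q) \<in> r"
        using G p(1) q(1) unfolding filter_in_order_def by blast
      then show ?thesis using p q by (intro bexI[of _ s]) (auto simp: r_def lessThan_Suc)
    next
      case False then show ?thesis using p by (intro bexI[of _ p]) (auto simp: lessThan_Suc)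
    qed
  qed
  have "emeasure M (B \<inter> {..<N}) \<le> 1" for N
  proof -
    obtain p where p: "p \<in> G" "B \<inter> {..<N} \<subseteq> snd p" using fin_part by blast
    then have "emeasure M (B \<inter> {..<N}) \<le> emeasure M (snd p)" using sets by (intro emeasure_mono) auto
    then show ?thesis using p GP by (force simp: P_def)
  qed
  moreover have "(\<lambda>N. emeasure M (B \<inter> {..<N})) \<longlonglongrightarrow> emeasure M (\<Union>N. B \<inter> {..<N})"
    using sets by (intro Lim_emeasure_incseq) (force simp: incseq_def)+
  moreover have "(\<Union>N. B \<inter> {..<N}) = B" by auto
  ultimately have "emeasure M B \<le> 1" by (metis LIMSEQ_le_const2)
  then have "emeasure M B < \<infinity>" by (simp add: le_less_trans)
  moreover have "finite (A - B)" if "A \<in> \<F>" for A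
  proof -
    have "G \<inter> D A \<noteq> {}" using meets that by (rule bspec)
    then obtain p where p: "p \<in> G" "p \<in> D A" by blast
    have "A - {..<fst p} \<subseteq> snd p" using p(2) by (simp add: D_def)
    moreover have "snd p \<subseteq> B" using p(1) by (auto simp: B_def)
    ultimately have "A - B \<subseteq> {..<fst p}" by blast
    then show ?thesis using finite_subset by blast
  qed
  ultimately show ?thesis by blast
qed

text \<open>The sets are chosen by recursion along \<open>r\<close>, whose proper initial segments
  are smaller than the continuum, so that \<open>MA_almost_upper_bound\<close> applies at each
  stage. The indices are themselves codes of sets of naturals, which makes the sequence cofinal:
  stage \<open>a\<close> absorbs the set coded by \<open>a\<close>.\<close>

lemma MA_almost_chain:
  fixes M :: "nat measure" and r :: "(nat \<Rightarrow> bool) rel"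
  assumes MA and sets: "sets M = UNIV" and r: "r = card_of UNIV"
  obtains A :: "(nat \<Rightarrow> bool) \<Rightarrow> nat set"
  where "\<And>a. emeasure M (A a) < \<infinity>"
    and "\<And>a b. (b, a) \<in> r \<Longrightarrow> finite (A b - A a)"
    and "\<And>B. emeasure M B < \<infinity> \<Longrightarrow> \<exists>a. B \<subseteq> A a"
proof -
  have wo: "Well_order r" and F: "Field r = UNIV" and co: "Card_order r"
    unfolding r by (rule card_of_Well_order, rule Field_card_of, rule card_of_Card_order)
  have wf: "wf (r - Id)" using wo by (simp add: well_order_on_def)
  define Q where "Q A a B \<longleftrightarrow> emeasure M B < \<infinity> \<and> (\<forall>b\<in>underS r a. finite (A b - B))
    \<and> (emeasure M {n. a n} < \<infinity> \<longrightarrow> {n. a n} \<subseteq> B)" for A :: "(nat \<Rightarrow> bool) \<Rightarrow> nat set" and a B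
  have "\<exists>A. \<forall>a. Q A a (A a)"
  proof (rule dependent_wf_choice[OF wf])
    fix A A' :: "(nat \<Rightarrow> bool) \<Rightarrow> nat set" and a B assume "\<And>z. (z, a) \<in> r - Id \<Longrightarrow> A z = A' z"
    then show "Q A a B = Q A' a B" by (auto simp: Q_def underS_def)
  next
    fix a and A :: "(nat \<Rightarrow> bool) \<Rightarrow> nat set" assume IH: "\<And>b. (b, a) \<in> r - Id \<Longrightarrow> Q A b (A b)"
    have "underS r a \<prec> (UNIV :: (nat \<Rightarrow> bool) set)"
    proof -
      have L: "ordLess2 (card_of (underS r a)) (card_of (UNIV :: (nat \<Rightarrow> bool) set))"
        using card_of_underS[OF co, of a] F by (simp add: r)
      show ?thesis
        unfolding lesspoll_def
      proof
        show "underS r a \<lesssim> (UNIV :: (nat \<Rightarrow> bool) set)"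
          using card_of_ordLeq[THEN iffD2, OF ordLess_imp_ordLeq[OF L]] unfolding lepoll_def .
        show "\<not> underS r a \<approx> (UNIV :: (nat \<Rightarrow> bool) set)"
          using not_ordLess_ordIso[OF L] by (simp only: eqpoll_iff_card_of_ordIso not_False_eq_True)
      qed
    qed
    then have "A ` underS r a \<prec> (UNIV :: (nat \<Rightarrow> bool) set)"
      using image_lepoll lesspoll_trans1 by blast
    moreover have "emeasure M (A b) < \<infinity>" if "b \<in> underS r a" for b
      using IH[of b] that by (auto simp: underS_def Q_def)
    ultimately obtain B where B: "emeasure M B < \<infinity>" "\<forall>b\<in>underS r a. finite (A b - B)"
      using MA_almost_upper_bound[OF \<open>MA\<close> sets, of "A ` underS r a"] by auto
    define C where "C = (if emeasure M {n. a n} < \<infinity> then {n. a n} else {})"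
    have "emeasure M (B \<union> C) < \<infinity>" using B(1)
      by (intro emeasure_Un_less sets) (auto simp: C_def)
    moreover have "finite (A b - (B \<union> C))" if "b \<in> underS r a" for b
      using B(2) that by (auto intro: finite_subset[of _ "A b - B"])
    ultimately have "Q A a (B \<union> C)" by (auto simp: Q_def C_def)
    then show "\<exists>B. Q A a B" ..
  qed
  then obtain A where A: "\<And>a. Q A a (A a)" by blast
  show ?thesis
  proof (rule that[of A])
    show "emeasure M (A a) < \<infinity>" for a using A[of a] by (simp add: Q_def)
    show "finite (A b - A a)" if "(b, a) \<in> r" for a b
      using A[of a] that by (cases "a = b") (auto simp: Q_def underS_def)
    show "\<exists>a. B \<subseteq> A a" if "emeasure M B < \<infinity>" for B
      using A[of "\<lambda>n. n \<in> B"] that by (intro exI[of _ "\<lambda>n. n \<in> B"]) (auto simp: Q_def)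
  qed
qed

subsection \<open>Extension of finitely additive measures on clopen sets\<close>

text \<open>Compactness does the work of countable additivity: open sets that cover a clopen set do
  so with finitely many of them. The clopen content \<open>m\<close> extends from inside to open
  sets as \<open>\<nu>\<close>, from outside to all sets as \<open>\<mu>\<close>, and Caratheodory's
  theorem makes \<open>\<mu>\<close> a measure on the Borel sets.\<close>

lemma radon_extension:
  fixes X :: "'a topology" and m :: "'a set \<Rightarrow> ennreal"
  assumes comp: "compact_space X"
    and base: "\<And>U x. openin X U \<Longrightarrow> x \<in> U \<Longrightarrow> \<exists>V. openin X V \<and> closedin X V \<and> x \<in> V \<and> V \<subseteq> U"
    and m0: "m {} = 0"
    and add: "\<And>V W. \<lbrakk>openin X V; closedin X V; openin X W; closedin X W; V \<inter> W = {}\<rbrakk>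
      \<Longrightarrow> m (V \<union> W) = m V + m W"
    and fin: "m (topspace X) < \<infinity>"
  obtains M where "radon_measure_on X M"
    "\<And>V. openin X V \<Longrightarrow> closedin X V \<Longrightarrow> emeasure M V = m V"
proof -
  define cl where "cl V \<longleftrightarrow> openin X V \<and> closedin X V" for V
  have cl_Int: "cl (V \<inter> W)" and cl_Un: "cl (V \<union> W)" and cl_Diff: "cl (V - W)"
    if "cl V" "cl W" for V W
    using that by (auto simp: cl_def openin_diff closedin_diff)
  have cl_empty: "cl {}" by (auto simp: cl_def)
  have cl_Union: "cl (\<Union>\<V>)" if "finite \<V>" "\<forall>V\<in>\<V>. cl V" for \<V>
    using that by (induction \<V> rule: finite_induct) (auto intro: cl_Un cl_empty)
  have m_Diff: "m W = m V + m (W - V)" if "cl V" "cl W" "V \<subseteq> W" for V W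
    using add[of V "W - V"] cl_Diff[OF that(2,1)] that by (auto simp: cl_def Un_absorb1)
  have m_mono: "m V \<le> m W" if "cl V" "cl W" "V \<subseteq> W" for V W
    using m_Diff[OF that] by simp
  have sep: "\<exists>V. cl V \<and> C \<subseteq> V \<and> V \<subseteq> U" if C: "closedin X C" and U: "openin X U" and CU: "C \<subseteq> U" for C U
  proof -
    have "compactin X C" using comp C by (rule closedin_compact_space)
    moreover have "C \<subseteq> \<Union>{V. cl V \<and> V \<subseteq> U}" using base[OF U] CU unfolding cl_def by blast
    ultimately obtain \<F> where "finite \<F>" "\<F> \<subseteq> {V. cl V \<and> V \<subseteq> U}" "C \<subseteq> \<Union>\<F>"
      using compactinD[of X C "{V. cl V \<and> V \<subseteq> U}"] by (auto simp: cl_def)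
    then show ?thesis using cl_Union[of \<F>] by (intro exI[of _ "\<Union>\<F>"]) blast
  qed
  define \<nu> where "\<nu> U = (SUP V\<in>{V. cl V \<and> V \<subseteq> U}. m V)" for U
  have nu_cl: "\<nu> V = m V" if "cl V" for V
    unfolding \<nu>_def using that by (intro antisym SUP_least SUP_upper) (auto intro: m_mono)
  have nu_upper: "m V \<le> \<nu> U" if "cl V" "V \<subseteq> U" for V U
    unfolding \<nu>_def using that by (intro SUP_upper) auto
  have nu_mono: "\<nu> U \<le> \<nu> W" if "U \<subseteq> W" for U W
    unfolding \<nu>_def using that by (intro SUP_subset_mono) auto
  have nu_Un: "\<nu> (U \<union> W) \<le> \<nu> U + \<nu> W" if U: "openin X U" and W: "openin X W" for U W
    unfolding \<nu>_def[of "U \<union> W"]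
  proof (rule SUP_least)
    fix V assume "V \<in> {V. cl V \<and> V \<subseteq> U \<union> W}"
    then have V: "cl V" "V \<subseteq> U \<union> W" by auto
    \<comment> \<open>\<open>V - W\<close> is closed inside \<open>U\<close>, so a clopen
      \<open>V'\<close> squeezed in between splits \<open>V\<close> into a part in \<open>U\<close>
      and a part in \<open>W\<close>.\<close>
    have "closedin X (V - W)" using V(1) W by (auto simp: cl_def closedin_diff)
    then obtain V' where V': "cl V'" "V - W \<subseteq> V'" "V' \<subseteq> U" using sep[OF _ U] V(2) by blast
    have "m V = m (V \<inter> V') + m (V - V \<inter> V')" using V V' cl_Int by (intro m_Diff) auto
    also have "\<dots> \<le> \<nu> U + \<nu> W"
      using V V' cl_Int cl_Diff by (intro add_mono nu_upper) auto
    finally show "m V \<le> \<nu> U + \<nu> W" .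
  qed
  have nu_UN_fin: "\<nu> (\<Union>i<n. U i) \<le> (\<Sum>i<n. \<nu> (U i))" if U: "\<And>i. openin X (U i)" for U :: "nat \<Rightarrow> 'a set" and n
  proof (induction n)
    case 0 then show ?case by (simp add: nu_cl cl_empty m0)
  next
    case (Suc n)
    have "\<nu> (\<Union>i<Suc n. U i) \<le> \<nu> (\<Union>i<n. U i) + \<nu> (U n)"
      unfolding lessThan_Suc UN_insert by (subst Un_commute) (intro nu_Un openin_Union; use U in auto)
    also have "\<dots> \<le> (\<Sum>i<Suc n. \<nu> (U i))" using Suc by (simp add: add_mono)
    finally show ?case .
  qed
  have nu_UN: "\<nu> (\<Union>i. U i) \<le> (\<Sum>i. \<nu> (U i))" if U: "\<And>i. openin X (U i)" for U :: "nat \<Rightarrow> 'a set"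
    unfolding \<nu>_def[of "\<Union>i. U i"]
  proof (rule SUP_least)
    fix V assume "V \<in> {V. cl V \<and> V \<subseteq> (\<Union>i. U i)}"
    then have V: "cl V" "V \<subseteq> (\<Union>i. U i)" by auto
    have "compactin X V" using comp V(1) by (auto simp: cl_def intro: closedin_compact_space)
    then obtain \<F> where F: "finite \<F>" "\<F> \<subseteq> range U" "V \<subseteq> \<Union>\<F>"
      using compactinD[of X V "range U"] U V(2) by auto
    then obtain J where J: "finite J" "\<F> = U ` J" using finite_subset_image by metis
    obtain n where n: "J \<subseteq> {..<n}" using J(1) finite_nat_iff_bounded by blast
    have "m V \<le> \<nu> (\<Union>i<n. U i)" using V(1) F(3) J(2) n by (intro nu_upper) auto
    also have "\<dots> \<le> (\<Sum>i<n. \<nu> (U i))" by (rule nu_UN_fin[OF U])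
    also have "\<dots> \<le> (\<Sum>i. \<nu> (U i))" by (intro sum_le_suminf) auto
    finally show "m V \<le> (\<Sum>i. \<nu> (U i))" .
  qed
  define \<Omega> where "\<Omega> = topspace X"
  define \<mu> where "\<mu> E = (INF U\<in>{U. openin X U \<and> E \<subseteq> U}. \<nu> U)" for E
  have mu_le: "\<mu> E \<le> \<nu> U" if "openin X U" "E \<subseteq> U" for E U
    unfolding \<mu>_def using that by (intro INF_lower) auto
  have mu_open: "\<mu> U = \<nu> U" if "openin X U" for U
    unfolding \<mu>_def using that by (intro antisym INF_greatest INF_lower) (auto intro: nu_mono)
  have mu_mono: "\<mu> A \<le> \<mu> B" if "A \<subseteq> B" for A B
    unfolding \<mu>_def using that by (intro INF_superset_mono) auto
  have mu_fin: "\<mu> E < \<infinity>" if "E \<subseteq> \<Omega>" for E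
  proof -
    have "\<mu> E \<le> \<nu> \<Omega>" using that by (intro mu_le) (auto simp: \<Omega>_def)
    also have "\<nu> \<Omega> = m \<Omega>" by (rule nu_cl) (auto simp: cl_def \<Omega>_def)
    finally show ?thesis using fin by (simp add: \<Omega>_def le_less_trans)
  qed
  have mu_approx: "\<exists>U. openin X U \<and> E \<subseteq> U \<and> \<nu> U \<le> \<mu> E + e" if "E \<subseteq> \<Omega>" "e > 0" for E e
  proof -
    have "\<mu> E < \<mu> E + e" using mu_fin[OF that(1)] that(2) ennreal_add_left_cancel_less[of "\<mu> E" 0 e] by simp
    then show ?thesis unfolding \<mu>_def[of E] INF_less_iff by (auto intro: less_imp_le)
  qed
  interpret P: sigma_algebra \<Omega> "Pow \<Omega>" by (rule sigma_algebra_Pow)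
  have pos: "positive (Pow \<Omega>) \<mu>"
    by (auto simp: positive_def mu_open nu_cl cl_empty m0)
  have csa: "countably_subadditive (Pow \<Omega>) \<mu>"
    unfolding countably_subadditive_def
  proof (intro allI impI)
    fix A :: "nat \<Rightarrow> 'a set" assume A: "range A \<subseteq> Pow \<Omega>"
    show "\<mu> (\<Union>i. A i) \<le> (\<Sum>i. \<mu> (A i))"
    proof (rule ennreal_le_epsilon)
      fix e :: real assume e: "0 < e"
      have "\<exists>U. openin X U \<and> A i \<subseteq> U \<and> \<nu> U \<le> \<mu> (A i) + ennreal (e * (1/2) ^ Suc i)" for i
        using A e by (intro mu_approx) auto
      then obtain U where U: "\<And>i. openin X (U i)" "\<And>i. A i \<subseteq> U i"
        "\<And>i. \<nu> (U i) \<le> \<mu> (A i) + ennreal (e * (1/2) ^ Suc i)" by metis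
      have "\<mu> (\<Union>i. A i) \<le> \<nu> (\<Union>i. U i)" using U by (intro mu_le openin_Union) blast+
      also have "\<dots> \<le> (\<Sum>i. \<nu> (U i))" by (rule nu_UN) (rule U)
      also have "\<dots> \<le> (\<Sum>i. \<mu> (A i) + ennreal (e * (1/2) ^ Suc i))" by (intro suminf_le U(3)) auto
      also have "\<dots> = (\<Sum>i. \<mu> (A i)) + (\<Sum>i. ennreal (e * (1/2) ^ Suc i))" by (rule suminf_add[symmetric]) auto
      also have "(\<Sum>i. ennreal (e * (1/2) ^ Suc i)) = ennreal e"
        using e sums_mult[OF power_half_series, of e] by (intro suminf_ennreal_eq) auto
      finally show "\<mu> (\<Union>i. A i) \<le> (\<Sum>i. \<mu> (A i)) + ennreal e" .
    qed
  qed
  have oms: "outer_measure_space (Pow \<Omega>) \<mu>"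
    using pos csa mu_mono by (auto simp: outer_measure_space_def increasing_def)
  have sa: "subadditive (Pow \<Omega>) \<mu>" using P.countably_subadditive_subadditive[OF pos csa] .
  have open_L: "U \<in> lambda_system \<Omega> (Pow \<Omega>) \<mu>" if U: "openin X U" for U
    unfolding P.lambda_system_eq
  proof (intro CollectI conjI ballI antisym)
    show "U \<in> Pow \<Omega>" using openin_subset[OF U] by (simp add: \<Omega>_def)
    fix E assume E: "E \<in> Pow \<Omega>"
    have "\<mu> ((E \<inter> U) \<union> (E - U)) \<le> \<mu> (E \<inter> U) + \<mu> (E - U)"
      using E by (intro subadditiveD[OF sa]) auto
    then show "\<mu> E \<le> \<mu> (E \<inter> U) + \<mu> (E - U)" by (simp add: Int_Diff_Un)
    \<comment> \<open>Two approximations from inside: \<open>V\<close> exhausts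
      \<open>W \<inter> U\<close>, then \<open>V'\<close> exhausts the open set
      \<open>W - V\<close>, which contains \<open>E - U\<close>. The disjoint clopen sets
      \<open>V\<close> and \<open>V'\<close> inside \<open>W\<close> together contribute at most
      \<open>\<nu> W\<close>.\<close>
    show "\<mu> (E \<inter> U) + \<mu> (E - U) \<le> \<mu> E"
      unfolding \<mu>_def[of E]
    proof (rule INF_greatest)
      fix W assume "W \<in> {W. openin X W \<and> E \<subseteq> W}"
      then have W: "openin X W" "E \<subseteq> W" by auto
      have "\<mu> (E \<inter> U) + \<mu> (E - U) \<le> \<nu> (W \<inter> U) + \<mu> (E - U)"
        using W U by (intro add_right_mono mu_le) auto
      also have "\<dots> = (SUP V\<in>{V. cl V \<and> V \<subseteq> W \<inter> U}. m V + \<mu> (E - U))"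
        unfolding \<nu>_def by (rule ennreal_SUP_add_left[symmetric]) (use cl_empty in auto)
      also have "\<dots> \<le> \<nu> W"
      proof (rule SUP_least)
        fix V assume "V \<in> {V. cl V \<and> V \<subseteq> W \<inter> U}"
        then have V: "cl V" "V \<subseteq> W" "V \<subseteq> U" by auto
        have "openin X (W - V)" using W V by (auto simp: cl_def openin_diff)
        then have "m V + \<mu> (E - U) \<le> m V + \<nu> (W - V)"
          using W V by (intro add_left_mono mu_le) auto
        also have "\<dots> = (SUP V'\<in>{V'. cl V' \<and> V' \<subseteq> W - V}. m V + m V')"
          unfolding \<nu>_def by (rule ennreal_SUP_add_right) (use cl_empty in auto)
        also have "\<dots> \<le> \<nu> W"
        proof (rule SUP_least)
          fix V' assume "V' \<in> {V'. cl V' \<and> V' \<subseteq> W - V}"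
          then have V': "cl V'" "V' \<subseteq> W - V" by auto
          then have "m V + m V' = m (V \<union> V')" using V by (intro add[symmetric]) (auto simp: cl_def)
          also have "\<dots> \<le> \<nu> W" using V V' by (intro nu_upper cl_Un) auto
          finally show "m V + m V' \<le> \<nu> W" .
        qed
        finally show "m V + \<mu> (E - U) \<le> \<nu> W" .
      qed
      finally show "\<mu> (E \<inter> U) + \<mu> (E - U) \<le> \<nu> W" .
    qed
  qed
  define S where "S = sigma_sets \<Omega> {U. openin X U}"
  have opens: "{U. openin X U} \<subseteq> Pow \<Omega>" using openin_subset by (auto simp: \<Omega>_def)
  have sS: "sigma_algebra \<Omega> S" unfolding S_def using opens by (rule sigma_algebra_sigma_sets)
  have ms: "measure_space \<Omega> (lambda_system \<Omega> (Pow \<Omega>) \<mu>) \<mu>" using oms by (rule P.caratheodory_lemma)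
  then have "sigma_algebra \<Omega> (lambda_system \<Omega> (Pow \<Omega>) \<mu>)" by (simp add: measure_space_def)
  then have "S \<subseteq> lambda_system \<Omega> (Pow \<Omega>) \<mu>" unfolding S_def
    by (rule sigma_algebra.sigma_sets_subset) (use open_L in auto)
  then have msS: "measure_space \<Omega> S \<mu>" using ms sS by (blast intro: measure_down)
  define M where "M = measure_of \<Omega> S \<mu>"
  have S_Pow: "S \<subseteq> Pow \<Omega>" using sS by (simp add: sigma_algebra_iff2)
  have spM: "space M = \<Omega>" and seM: "sets M = S"
    using S_Pow sS by (auto simp: M_def sigma_algebra.sigma_sets_eq)
  have emM: "emeasure M B = \<mu> B" if "B \<in> S" for B
    unfolding M_def using sS msS that by (intro emeasure_measure_of_sigma) (auto simp: measure_space_def)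
  have openS: "U \<in> S" if "openin X U" for U using that by (auto simp: S_def)
  have "radon_measure_on X M"
    unfolding radon_measure_on_def
  proof (intro conjI ballI)
    show "space M = topspace X" by (simp add: spM \<Omega>_def)
    show "sets M = sigma_sets (topspace X) {U. openin X U}" by (simp add: seM S_def \<Omega>_def)
    have "emeasure M (space M) < \<infinity>"
      unfolding spM using mu_fin[of \<Omega>] emM[OF openS[of \<Omega>]] by (simp add: \<Omega>_def)
    then show fM: "finite_measure M" by (intro finite_measureI) auto
    fix B assume B: "B \<in> sets M"
    then have BS: "B \<in> S" "B \<subseteq> \<Omega>" using S_Pow seM by auto
    show "emeasure M B = (SUP C\<in>{C \<in> sets M. C \<subseteq> B \<and> compactin X C}. emeasure M C)"
    proof (rule antisym)
      show "(SUP C\<in>{C \<in> sets M. C \<subseteq> B \<and> compactin X C}. emeasure M C) \<le> emeasure M B"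
        using B by (intro SUP_least emeasure_mono) auto
      show "emeasure M B \<le> (SUP C\<in>{C \<in> sets M. C \<subseteq> B \<and> compactin X C}. emeasure M C)"
      proof (rule ennreal_le_epsilon)
        fix e :: real assume e: "0 < e"
        \<comment> \<open>Inner regularity of \<open>B\<close> is outer regularity of its
          complement: an open \<open>U\<close> around \<open>\<Omega> - B\<close> has a compact
          complement inside \<open>B\<close>, and exceeds \<open>\<Omega> - B\<close> only by
          \<open>B \<inter> U\<close>.\<close>
        obtain U where U: "openin X U" "\<Omega> - B \<subseteq> U" "\<nu> U \<le> \<mu> (\<Omega> - B) + ennreal e"
          using mu_approx[of "\<Omega> - B" "ennreal e"] e by auto
        have UM: "U \<in> sets M" using openS[OF U(1)] seM by simp
        have "\<Omega> - B \<in> sets M" using B spM by (metis sets.compl_sets)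
        have U\<Omega>: "U \<subseteq> \<Omega>" using openin_subset[OF U(1)] by (simp add: \<Omega>_def)
        let ?C = "\<Omega> - U"
        have "closedin X ?C" using U(1) by (auto simp: \<Omega>_def)
        then have C: "compactin X ?C" using comp by (rule closedin_compact_space[rotated])
        have CM: "?C \<in> sets M" using UM spM by (metis sets.compl_sets)
        have "emeasure M (\<Omega> - B) + emeasure M (B \<inter> U) = emeasure M U"
          using B UM \<open>\<Omega> - B \<in> sets M\<close> U(2) U\<Omega>
          by (subst plus_emeasure) (auto intro!: arg_cong[where f = "emeasure M"])
        also have "\<dots> \<le> emeasure M (\<Omega> - B) + ennreal e"
          using U(3) emM[OF openS[OF U(1)]] mu_open[OF U(1)] emM[of "\<Omega> - B"] \<open>\<Omega> - B \<in> sets M\<close> seM by simp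
        finally have BU: "emeasure M (B \<inter> U) \<le> ennreal e"
          using finite_measure.emeasure_finite[OF fM, of "\<Omega> - B"] by (simp add: ennreal_add_left_cancel_le)
        have "emeasure M B \<le> emeasure M (?C \<union> B \<inter> U)"
          using CM B UM BS by (intro emeasure_mono) auto
        also have "\<dots> \<le> emeasure M ?C + emeasure M (B \<inter> U)"
          using CM B UM by (intro emeasure_subadditive) auto
        also have "\<dots> \<le> (SUP C\<in>{C \<in> sets M. C \<subseteq> B \<and> compactin X C}. emeasure M C) + ennreal e"
          using CM C U(2) BU by (intro add_mono SUP_upper) auto
        finally show "emeasure M B \<le> (SUP C\<in>{C \<in> sets M. C \<subseteq> B \<and> compactin X C}. emeasure M C) + ennreal e" .
      qed
    qed
  qed
  moreover have "emeasure M V = m V" if "openin X V" "closedin X V" for V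
    using emM[OF openS[OF that(1)]] mu_open[OF that(1)] nu_cl that by (simp add: cl_def)
  ultimately show ?thesis by (rule that)
qed

subsection \<open>Spaces of finitely realized types\<close>

text \<open>This is the Stone space of the algebra of subsets of \<open>Z\<close> generated by the
  sets \<open>G c\<close>. An ultrafilter is determined by the set \<open>x\<close> of indices of
  generators that it contains, and the sets that arise are those finitely satisfiable in
  \<open>Z\<close>.\<close>

definition realized :: "'z set \<Rightarrow> ('i \<Rightarrow> 'z set) \<Rightarrow> 'i set set" where
  "realized Z G = {x. \<forall>F. finite F \<longrightarrow> (\<exists>z\<in>Z. \<forall>c\<in>F. c \<in> x \<longleftrightarrow> z \<in> G c)}"

definition cyl :: "'z set \<Rightarrow> ('i \<Rightarrow> 'z set) \<Rightarrow> 'i set \<Rightarrow> 'i set \<Rightarrow> 'i set set" where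
  "cyl Z G F x = {y \<in> realized Z G. y \<inter> F = x \<inter> F}"

definition type_space :: "'z set \<Rightarrow> ('i \<Rightarrow> 'z set) \<Rightarrow> 'i set topology" where
  "type_space Z G =
     topology (\<lambda>U. U \<subseteq> realized Z G \<and> (\<forall>x\<in>U. \<exists>F. finite F \<and> cyl Z G F x \<subseteq> U))"

lemma openin_type_space:
  "openin (type_space Z G) U \<longleftrightarrow> U \<subseteq> realized Z G \<and> (\<forall>x\<in>U. \<exists>F. finite F \<and> cyl Z G F x \<subseteq> U)"
proof -
  have "istopology (\<lambda>U. U \<subseteq> realized Z G \<and> (\<forall>x\<in>U. \<exists>F. finite F \<and> cyl Z G F x \<subseteq> U))"
    unfolding istopology_def
  proof (rule conjI; intro allI impI)
    fix S T
    assume S: "S \<subseteq> realized Z G \<and> (\<forall>x\<in>S. \<exists>F. finite F \<and> cyl Z G F x \<subseteq> S)"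
      and T: "T \<subseteq> realized Z G \<and> (\<forall>x\<in>T. \<exists>F. finite F \<and> cyl Z G F x \<subseteq> T)"
    have "\<exists>F. finite F \<and> cyl Z G F x \<subseteq> S \<inter> T" if x: "x \<in> S \<inter> T" for x
    proof -
      obtain F1 F2 where "finite F1" "cyl Z G F1 x \<subseteq> S" "finite F2" "cyl Z G F2 x \<subseteq> T"
        using S T x by blast
      moreover have "cyl Z G (F1 \<union> F2) x \<subseteq> cyl Z G F1 x \<inter> cyl Z G F2 x"
        by (auto simp: cyl_def)
      ultimately show ?thesis by (intro exI[of _ "F1 \<union> F2"]) auto
    qed
    then show "S \<inter> T \<subseteq> realized Z G \<and> (\<forall>x\<in>S \<inter> T. \<exists>F. finite F \<and> cyl Z G F x \<subseteq> S \<inter> T)"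
      using S by blast
  next
    fix \<K> assume "\<forall>K\<in>\<K>. K \<subseteq> realized Z G \<and> (\<forall>x\<in>K. \<exists>F. finite F \<and> cyl Z G F x \<subseteq> K)"
    then show "\<Union>\<K> \<subseteq> realized Z G \<and> (\<forall>x\<in>\<Union>\<K>. \<exists>F. finite F \<and> cyl Z G F x \<subseteq> \<Union>\<K>)"
      by (meson Sup_le_iff UnionE Union_upper order_trans)
  qed
  then show ?thesis by (simp add: type_space_def topology_inverse')
qed

lemma openin_cyl: "finite F \<Longrightarrow> openin (type_space Z G) (cyl Z G F x)"
  by (auto simp: openin_type_space cyl_def)

lemma topspace_type_space [simp]: "topspace (type_space Z G) = realized Z G"
proof
  show "topspace (type_space Z G) \<subseteq> realized Z G"
    using openin_topspace[of "type_space Z G"] by (auto simp only: openin_type_space)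
  have "openin (type_space Z G) (realized Z G)"
    unfolding openin_type_space cyl_def by auto
  then show "realized Z G \<subseteq> topspace (type_space Z G)" by (rule openin_subset)
qed

lemma openin_type_space_determined:
  assumes "finite F" "U \<subseteq> realized Z G"
    "\<And>x y. x \<in> U \<Longrightarrow> y \<in> realized Z G \<Longrightarrow> y \<inter> F = x \<inter> F \<Longrightarrow> y \<in> U"
  shows "openin (type_space Z G) U"
  using assms unfolding openin_type_space cyl_def by blast

lemma openin_type_space_mem:
  "openin (type_space Z G) {x \<in> realized Z G. c \<in> x}"
  "openin (type_space Z G) {x \<in> realized Z G. c \<notin> x}"
  by (rule openin_type_space_determined[of "{c}"]; auto)+

lemma closedin_cyl: assumes "finite F" shows "closedin (type_space Z G) (cyl Z G F x)"
proof -
  have "openin (type_space Z G) (realized Z G - cyl Z G F x)"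
    using assms by (rule openin_type_space_determined) (auto simp: cyl_def)
  then show ?thesis by (auto simp: closedin_def cyl_def)
qed

lemma Hausdorff_type_space: "Hausdorff_space (type_space Z G)"
  unfolding Hausdorff_space_def
proof (intro allI impI)
  fix x y assume xy: "x \<in> topspace (type_space Z G) \<and> y \<in> topspace (type_space Z G) \<and> x \<noteq> y"
  then obtain c where "(c \<in> x) \<noteq> (c \<in> y)" by blast
  then have "x \<in> cyl Z G {c} x" "y \<in> cyl Z G {c} y" "disjnt (cyl Z G {c} x) (cyl Z G {c} y)"
    using xy by (auto simp: cyl_def disjnt_def)
  then show "\<exists>U V. openin (type_space Z G) U \<and> openin (type_space Z G) V \<and> x \<in> U \<and> y \<in> V \<and> disjnt U V"
    by (meson finite.emptyI finite.insertI openin_cyl)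
qed

text \<open>Failure of finite satisfiability is visible on finitely many coordinates, so the
  realized sets form a closed subset of a power of the two-point space. Compactness is Tychonoff's
  theorem, carried over by \<open>Collect\<close>.\<close>

lemma compact_type_space: "compact_space (type_space Z G)"
proof -
  let ?X = "product_topology (\<lambda>_::'i. discrete_topology (UNIV :: bool set)) UNIV"
  have agree: "openin ?X {g. \<forall>c\<in>F. g c = f c}" if "finite F" for F and f :: "'i \<Rightarrow> bool"
  proof -
    have "openin ?X (\<Pi>\<^sub>E i\<in>UNIV. if i \<in> F then {f i} else UNIV)"
      using that by (intro product_topology_basis) (auto intro: finite_subset)
    moreover have "(\<Pi>\<^sub>E i\<in>UNIV. if i \<in> F then {f i} else UNIV) = {g. \<forall>c\<in>F. g c = f c}"
      by (auto simp: PiE_iff split: if_splits)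
    ultimately show ?thesis by simp
  qed
  let ?S = "{f. Collect f \<in> realized Z G}"
  have "openin ?X (- ?S)"
  proof (subst openin_subopen, intro ballI)
    fix f assume "f \<in> - ?S"
    then obtain F where F: "finite F" "\<not> (\<exists>z\<in>Z. \<forall>c\<in>F. f c \<longleftrightarrow> z \<in> G c)"
      by (auto simp: realized_def)
    show "\<exists>T. openin ?X T \<and> f \<in> T \<and> T \<subseteq> - ?S"
    proof (intro exI conjI)
      show "openin ?X {g. \<forall>c\<in>F. g c = f c}" using F(1) by (rule agree)
      show "{g. \<forall>c\<in>F. g c = f c} \<subseteq> - ?S"
      proof
        fix g assume g: "g \<in> {g. \<forall>c\<in>F. g c = f c}"
        then have "\<not> (\<exists>z\<in>Z. \<forall>c\<in>F. g c \<longleftrightarrow> z \<in> G c)" using F(2) by auto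
        then show "g \<in> - ?S" using F(1) by (auto simp: realized_def)
      qed
    qed auto
  qed
  then have "closedin ?X ?S" by (simp add: closedin_def Compl_eq_Diff_UNIV)
  moreover have "compact_space ?X"
    by (simp add: compact_space_product_topology compact_space_discrete_topology)
  ultimately have comp: "compactin ?X ?S" by (rule closedin_compact_space[rotated])
  have cont: "continuous_map (subtopology ?X ?S) (type_space Z G) Collect"
    unfolding continuous_map_def
  proof (intro conjI allI impI)
    show "Collect \<in> topspace (subtopology ?X ?S) \<rightarrow> topspace (type_space Z G)" by auto
    fix U assume U: "openin (type_space Z G) U"
    show "openin (subtopology ?X ?S) {f \<in> topspace (subtopology ?X ?S). Collect f \<in> U}"
    proof (subst openin_subopen, intro ballI)
      fix f assume "f \<in> {f \<in> topspace (subtopology ?X ?S). Collect f \<in> U}"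
      then have f: "Collect f \<in> U" by simp
      then obtain F where F: "finite F" "cyl Z G F (Collect f) \<subseteq> U"
        using U unfolding openin_type_space by blast
      show "\<exists>T. openin (subtopology ?X ?S) T \<and> f \<in> T \<and> T \<subseteq> {f \<in> topspace (subtopology ?X ?S). Collect f \<in> U}"
      proof (intro exI conjI)
        show "openin (subtopology ?X ?S) ({g. \<forall>c\<in>F. g c = f c} \<inter> ?S)"
          using agree[OF F(1)] by (rule openin_subtopology_Int)
        show "f \<in> {g. \<forall>c\<in>F. g c = f c} \<inter> ?S" using f U by (auto simp: openin_type_space)
        show "{g. \<forall>c\<in>F. g c = f c} \<inter> ?S \<subseteq> {f \<in> topspace (subtopology ?X ?S). Collect f \<in> U}"
          using F(2) by (auto simp: cyl_def)
      qed
    qed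
  qed
  have "compactin (type_space Z G) (Collect ` ?S)"
    using comp cont by (intro image_compactin[of "subtopology ?X ?S"]) (auto simp: compactin_subtopology)
  moreover have "Collect ` ?S = realized Z G"
    by (force intro: image_eqI[of _ _ "\<lambda>c. c \<in> x" for x])
  ultimately show ?thesis by (simp add: compact_space_def)
qed

text \<open>The principal ultrafilter at \<open>z\<close>. These points witness that open sets are
  nonempty, and clopen sets will be measured by the principal types in them.\<close>

definition principal_type :: "('i \<Rightarrow> 'z set) \<Rightarrow> 'z \<Rightarrow> 'i set" where
  "principal_type G z = {c. z \<in> G c}"

lemma principal_type_realized: "z \<in> Z \<Longrightarrow> principal_type G z \<in> realized Z G"
  by (auto simp: principal_type_def realized_def)

lemma realizedE:
  assumes "x \<in> realized Z G" "finite F"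
  obtains z where "z \<in> Z" "\<And>c. c \<in> F \<Longrightarrow> c \<in> x \<longleftrightarrow> z \<in> G c"
  using assms unfolding realized_def by blast

subsection \<open>Order topologies of well-orders\<close>

lemma Well_orderD:
  assumes "Well_order r"
  shows "x \<in> Field r \<Longrightarrow> y \<in> Field r \<Longrightarrow> x \<noteq> y \<Longrightarrow> (x, y) \<in> r \<or> (y, x) \<in> r"
    and "(x, y) \<in> r \<Longrightarrow> (y, z) \<in> r \<Longrightarrow> (x, z) \<in> r"
    and "(x, y) \<in> r \<Longrightarrow> (y, x) \<in> r \<Longrightarrow> x = y"
    and "x \<in> Field r \<Longrightarrow> (x, x) \<in> r"
  using assms
  by (auto simp: well_order_on_def linear_order_on_def total_on_def partial_order_on_def
      preorder_on_def antisym_def refl_on_def elim: transE)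

lemma openin_order_topology_rays:
  assumes "a \<in> Field r"
  shows "openin (order_topology_of r) (underS r a)" "openin (order_topology_of r) (aboveS r a)"
  unfolding order_topology_of_def using assms by (auto intro!: topology_generated_by_Basis)

text \<open>The second alternative says that the half-open interval from \<open>b\<close> to
  \<open>x\<close> lies in \<open>N\<close>. An intersection takes the larger of two bounds; a left
  ray contains the whole segment up to \<open>x\<close>, and a right ray excludes only what lies up
  to its end point.\<close>

lemma order_topology_of_left_nhd:
  assumes wo: "Well_order r" and N: "openin (order_topology_of r) N" and x: "x \<in> N"
  shows "under r x \<subseteq> N \<or> (\<exists>b\<in>underS r x. under r x \<subseteq> under r b \<union> N)"
proof -
  note W = Well_orderD[OF wo]
  have F: "x \<in> Field r" "y \<in> Field r" if "(x, y) \<in> r" for x y using that by (auto simp: Field_def)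
  have "generate_topology_on (insert (Field r) (underS r ` Field r \<union> aboveS r ` Field r)) N"
    using N unfolding order_topology_of_def by (rule openin_topology_generated_by)
  then show ?thesis using x
  proof (induction arbitrary: x rule: generate_topology_on.induct)
    case Empty then show ?case by simp
  next
    case (Int U V)
    have "x \<in> U" "x \<in> V" using Int.prems by auto
    note IH = Int.IH(1)[OF this(1)] Int.IH(2)[OF this(2)]
    show ?case
    proof (cases "under r x \<subseteq> U \<or> under r x \<subseteq> V")
      case True then show ?thesis using IH by blast
    next
      case False
      then obtain b c where b: "b \<in> underS r x" "under r x \<subseteq> under r b \<union> U"
        and c: "c \<in> underS r x" "under r x \<subseteq> under r c \<union> V" using IH by blast
      have "(b, c) \<in> r \<or> (c, b) \<in> r"
        using W(1)[of b c] W(4)[of b] b(1) c(1) F unfolding underS_def by blast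
      then have "under r b \<subseteq> under r c \<or> under r c \<subseteq> under r b" using W(2) unfolding under_def by blast
      then show ?thesis using b c by blast
    qed
  next
    case (UN \<K>)
    then obtain U where U: "U \<in> \<K>" "x \<in> U" by blast
    then have "U \<subseteq> \<Union>\<K>" by blast
    then show ?case using UN.IH[OF U] by blast
  next
    case (Basis U)
    then consider "U = Field r" | a where "U = underS r a" | a where "U = aboveS r a" by blast
    then show ?case
    proof cases
      case 1 then show ?thesis using F by (auto simp: under_def)
    next
      case 2
      then have x: "(x, a) \<in> r" "x \<noteq> a" using Basis.prems by (auto simp: underS_def)
      have "(y, a) \<in> r \<and> y \<noteq> a" if "(y, x) \<in> r" for y
        using W(2)[OF that x(1)] W(3)[OF that] x by metis
      then show ?thesis using 2 unfolding under_def underS_def by blast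
    next
      case 3
      then have a: "a \<in> underS r x" using Basis.prems by (auto simp: aboveS_def underS_def)
      then have aF: "a \<in> Field r" by (auto simp: underS_def Field_def)
      have "(y, a) \<in> r \<or> y \<noteq> a \<and> (a, y) \<in> r" if "(y, x) \<in> r" for y
        using W(1)[of y a] W(4)[OF aF] F(1)[OF that] aF by metis
      then have "under r x \<subseteq> under r a \<union> U" unfolding 3 under_def aboveS_def by blast
      then show ?thesis using a by blast
    qed
  qed
qed

text \<open>Without a maximum the open initial segments cover the order. A finite subcover is a
  chain, so one of its members would be everything, although it misses its own end point.\<close>

lemma compact_order_topology_of_max:
  assumes wo: "Well_order r" and comp: "compact_space (order_topology_of r)" and ne: "Field r \<noteq> {}"
  obtains b where "b \<in> Field r" "under r b = Field r"
proof -
  note W = Well_orderD[OF wo]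
  have "\<exists>b\<in>Field r. \<forall>x\<in>Field r. b \<notin> underS r x"
  proof (rule ccontr)
    assume "\<not> ?thesis"
    then have "compactin (order_topology_of r) (Field r)" "Field r \<subseteq> \<Union>(underS r ` Field r)"
      using comp by (auto simp: compact_space_def)
    then obtain \<F> where fin: "finite \<F>" "\<F> \<subseteq> underS r ` Field r" "Field r \<subseteq> \<Union>\<F>"
      using compactinD[of "order_topology_of r" "Field r" "underS r ` Field r"] openin_order_topology_rays(1)
      by (metis (no_types, lifting) imageE)
    have "subset.chain UNIV \<F>"
      unfolding subset_chain_def
    proof (intro conjI ballI)
      fix S T assume "S \<in> \<F>" "T \<in> \<F>"
      then obtain a b where "a \<in> Field r" "b \<in> Field r" "S = underS r a" "T = underS r b" using fin(2) by blast
      then show "S \<subseteq> T \<or> T \<subseteq> S" using W(1)[of a b] W(2,3) unfolding underS_def by blast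
    qed simp
    moreover have "\<F> \<noteq> {}" using fin(3) ne by auto
    ultimately have "\<Union>\<F> \<in> \<F>" using fin(1) Union_in_chain by blast
    then obtain a where "a \<in> Field r" "\<Union>\<F> = underS r a" using fin(2) by blast
    then show False using fin(3) by (auto simp: underS_def)
  qed
  then obtain b where b: "b \<in> Field r" "\<And>x. x \<in> Field r \<Longrightarrow> b \<notin> underS r x" by blast
  have "(x, b) \<in> r" if "x \<in> Field r" for x
    using b(2)[OF that] W(1)[of b x] W(4)[of b] b(1) that by (auto simp: underS_def)
  then have "under r b = Field r" by (auto simp: under_def Field_def)
  then show ?thesis using b(1) that by blast
qed

text \<open>Two points are separated by the rays at a point strictly between them, or by the rays of
  the jump that they form.\<close>

lemma Hausdorff_order_topology_of:
  assumes "Well_order r" shows "Hausdorff_space (order_topology_of r)"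
proof -
  let ?T = "order_topology_of r"
  note lin = Well_orderD(1)[OF assms] and as = Well_orderD(3)[OF assms]
  note op = openin_order_topology_rays[of _ r]
  have sep: "\<exists>U V. openin ?T U \<and> openin ?T V \<and> x \<in> U \<and> y \<in> V \<and> disjnt U V"
    if xy: "(x, y) \<in> r" "x \<noteq> y" for x y
  proof (cases "\<exists>z. z \<noteq> x \<and> z \<noteq> y \<and> (x, z) \<in> r \<and> (z, y) \<in> r")
    case True
    then obtain z where z: "z \<noteq> x" "z \<noteq> y" "(x, z) \<in> r" "(z, y) \<in> r" by blast
    then have "z \<in> Field r" by (auto simp: Field_def)
    moreover have "disjnt (underS r z) (aboveS r z)" using as by (auto simp: disjnt_def underS_def aboveS_def)
    moreover have "x \<in> underS r z" "y \<in> aboveS r z" using z by (auto simp: underS_def aboveS_def)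
    ultimately show ?thesis using op by blast
  next
    case False
    have "x \<in> Field r" "y \<in> Field r" using xy by (auto simp: Field_def)
    moreover have "disjnt (underS r y) (aboveS r x)"
      using False by (auto simp: disjnt_def underS_def aboveS_def)
    moreover have "x \<in> underS r y" "y \<in> aboveS r x" using xy by (auto simp: underS_def aboveS_def)
    ultimately show ?thesis using op by blast
  qed
  show ?thesis
    unfolding Hausdorff_space_def topspace_order_topology_of
  proof (intro allI impI, elim conjE)
    fix x y assume "x \<in> Field r" "y \<in> Field r" "x \<noteq> y"
    then consider "(x, y) \<in> r" | "(y, x) \<in> r" using lin by blast
    then show "\<exists>U V. openin ?T U \<and> openin ?T V \<and> x \<in> U \<and> y \<in> V \<and> disjnt U V"
    proof cases
      case 1 then show ?thesis using sep \<open>x \<noteq> y\<close> by blast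
    next
      case 2
      then obtain U V where "openin ?T U" "openin ?T V" "y \<in> U" "x \<in> V" "disjnt U V"
        using sep[of y x] \<open>x \<noteq> y\<close> by blast
      then show ?thesis using disjnt_sym by blast
    qed
  qed
qed

text \<open>A continuous injection of a compact space into a Hausdorff space is a homeomorphism onto
  its image. The target is the image of \<open>e\<close> with the restricted well-order, again an
  ordinal; its order topology may be coarser than the subspace topology, so only rays with end
  points in the image are tested.\<close>

lemma compact_homeomorphic_to_ordinal:
  fixes e :: "'a \<Rightarrow> 'i"
  assumes comp: "compact_space X" and wo: "Well_order r" and F: "Field r = UNIV"
    and inj: "inj_on e (topspace X)"
    and up: "\<And>a. openin X {x \<in> topspace X. e x \<in> aboveS r a}"
    and down: "\<And>a. openin X {x \<in> topspace X. e x \<in> under r a}"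
  shows "homeomorphic_to_ordinal X"
proof -
  define S where "S = e ` topspace X"
  define q where "q = Restr r S"
  have refl: "(x, x) \<in> r" for x using Well_orderD(4)[OF wo] F by simp
  have Fq: "Field q = S" using refl by (auto simp: q_def Field_def)
  note tr = Well_orderD(2)[OF wo] and as = Well_orderD(3)[OF wo]
  have woq: "Well_order q" unfolding q_def using wo by (rule Well_order_Restr)
  have cont: "continuous_map X (order_topology_of q) e"
    unfolding order_topology_of_def
  proof (rule continuous_on_generated_topo)
    fix U assume "U \<in> insert (Field q) (underS q ` Field q \<union> aboveS q ` Field q)"
    then consider "U = S" | b where "U = underS q b" "b \<in> S" | a where "U = aboveS q a" "a \<in> S"
      unfolding Fq by blast
    then show "openin X (e -` U \<inter> topspace X)"
    proof cases
      case 1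
      then have "e -` U \<inter> topspace X = topspace X" by (auto simp: S_def)
      then show ?thesis by simp
    next
      case 2
      \<comment> \<open>Strictly below \<open>b\<close> means below some \<open>a < b\<close> that need not lie in \<open>S\<close>.\<close>
      have "e -` U \<inter> topspace X = (\<Union>a\<in>underS r b. {x \<in> topspace X. e x \<in> under r a})"
        using 2 refl tr as by (auto simp: S_def q_def underS_def under_def)
      then show ?thesis using down by auto
    next
      case 3
      have "e -` U \<inter> topspace X = {x \<in> topspace X. e x \<in> aboveS r a}"
        using 3 by (auto simp: S_def q_def aboveS_def)
      then show ?thesis using up by auto
    qed
  next
    show "e ` topspace X \<subseteq> \<Union>(insert (Field q) (underS q ` Field q \<union> aboveS q ` Field q))"
      using Fq by (auto simp: S_def)
  qed
  have "homeomorphic_map X (order_topology_of q) e"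
    using cont comp Hausdorff_order_topology_of[OF woq] inj
    by (intro continuous_imp_homeomorphic_map) (auto simp: Fq S_def)
  then have "X homeomorphic_space order_topology_of q" by (auto simp: homeomorphic_space)
  then show ?thesis using woq by (rule homeomorphic_to_ordinalI[rotated])
qed

text \<open>
  The least \<open>\<xi>\<close> for which the image of \<open>{0..\<xi>}\<close> has nonempty interior would be continuous at \<open>\<xi>\<close>,
  so part of that interior is already covered by the image of some shorter initial segment.
\<close>

lemma ordinal_no_map_onto_interval:
  fixes h :: "'a \<Rightarrow> real"
  assumes ord: "homeomorphic_to_ordinal X" and comp: "compact_space X"
    and h: "continuous_map X euclideanreal h"
  shows "\<not> {0..1} \<subseteq> h ` topspace X"
proof
  assume onto: "{0..1} \<subseteq> h ` topspace X"
  obtain r :: "'a rel" where wo: "Well_order r" and X: "X homeomorphic_space order_topology_of r"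
    using ord unfolding homeomorphic_to_ordinal_def by blast
  let ?T = "order_topology_of r"
  obtain k where k: "homeomorphic_map ?T X k"
    using X homeomorphic_space_sym homeomorphic_space by metis
  define g where "g = h \<circ> k"
  have g: "continuous_map ?T euclideanreal g"
    unfolding g_def using k h homeomorphic_imp_continuous_map continuous_map_compose by blast
  have kF: "k ` Field r = topspace X" using homeomorphic_imp_surjective_map[OF k] by simp
  have onto: "{0..1} \<subseteq> g ` Field r" using onto unfolding g_def image_comp[symmetric] kF .
  have compT: "compact_space ?T" using comp X homeomorphic_compact_space by blast
  note W = Well_orderD[OF wo]
  have wf: "wf (r - Id)" using wo by (simp add: well_order_on_def)
  have F: "x \<in> Field r" "y \<in> Field r" if "(x, y) \<in> r" for x y using that by (auto simp: Field_def)
  have clo: "closed (g ` under r b)" if "b \<in> Field r" for b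
  proof -
    have "openin ?T (aboveS r b)"
      using that by (rule openin_order_topology_rays)
    moreover have "under r b = topspace ?T - aboveS r b"
      using that W(1,3,4) F by (auto simp: under_def aboveS_def) metis
    ultimately have "closedin ?T (under r b)" by (metis closedin_diff closedin_topspace)
    then have "compactin ?T (under r b)" using compT by (rule closedin_compact_space[rotated])
    then have "compactin euclideanreal (g ` under r b)" using g by (rule image_compactin)
    then show ?thesis by (simp add: compact_imp_closed)
  qed
  let ?big = "\<lambda>b. b \<in> Field r \<and> interior (g ` under r b) \<noteq> {}"
  have "\<exists>b. ?big b"
  proof -
    have "Field r \<noteq> {}" using onto by auto
    then obtain b where b: "b \<in> Field r" "under r b = Field r"
      using compact_order_topology_of_max[OF wo compT] by blast
    then have "{0<..<1} \<subseteq> interior (g ` under r b)"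
      using onto by (intro interior_maximal) (auto simp: subset_eq)
    moreover have "(1/2 :: real) \<in> {0<..<1}" by simp
    ultimately have "interior (g ` under r b) \<noteq> {}" by blast
    then show ?thesis using b by blast
  qed
  define Q where "Q = Collect ?big"
  from \<open>\<exists>b. ?big b\<close> obtain b0 where "b0 \<in> Q" by (auto simp: Q_def)
  then obtain \<xi> where Q: "\<xi> \<in> Q" "\<And>b. (b, \<xi>) \<in> r - Id \<Longrightarrow> b \<notin> Q"
    using wfE_min[OF wf] by metis
  then have xi: "?big \<xi>" and least: "\<And>b. (b, \<xi>) \<in> r - Id \<Longrightarrow> \<not> ?big b"
    unfolding Q_def mem_Collect_eq by simp_all
  \<comment> \<open>Singletons are not open in the reals, so \<open>V\<close> is nonempty. A small
    ball \<open>W\<close> around a point of \<open>V\<close> and the values on a neighbourhood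
    \<open>N\<close> of \<open>\<xi>\<close> are disjoint, so only a shorter segment can cover
    \<open>W\<close>.\<close>
  define V where "V = interior (g ` under r \<xi>) - {g \<xi>}"
  have "open V" by (auto simp: V_def)
  have "V \<noteq> {}"
  proof
    assume "V = {}"
    then have "interior (g ` under r \<xi>) \<subseteq> {g \<xi>}" by (auto simp: V_def)
    then have "interior (g ` under r \<xi>) = {g \<xi>}" using xi by blast
    then have "open {g \<xi>}" by (metis open_interior)
    then show False using not_open_singleton by blast
  qed
  then obtain v where v: "v \<in> V" by blast
  define d where "d = dist v (g \<xi>) / 2"
  have d: "d > 0" using v by (auto simp: d_def V_def)
  define W where "W = V \<inter> ball v d"
  have W: "open W" "v \<in> W" using \<open>open V\<close> v d by (auto simp: W_def)
  define N where "N = {x \<in> Field r. g x \<in> ball (g \<xi>) d}"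
  have N: "openin ?T N" unfolding N_def
    using openin_continuous_map_preimage[OF g, of "ball (g \<xi>) d"] by simp
  have "\<xi> \<in> N" using xi d by (auto simp: N_def)
  have disj: "g x \<notin> W" if "x \<in> N" for x
  proof
    assume "g x \<in> W"
    then have "dist v (g x) < d" "dist (g \<xi>) (g x) < d" using that by (auto simp: W_def N_def)
    then show False using dist_triangle2[of v "g \<xi>" "g x"] by (simp add: d_def dist_commute)
  qed
  have "\<exists>b. (b, \<xi>) \<in> r - Id \<and> under r \<xi> \<subseteq> under r b \<union> N \<or> under r \<xi> \<subseteq> N"
    using order_topology_of_left_nhd[OF wo N \<open>\<xi> \<in> N\<close>] by (auto simp: underS_def)
  then consider b where "(b, \<xi>) \<in> r - Id" "under r \<xi> \<subseteq> under r b \<union> N" | "under r \<xi> \<subseteq> N" by blast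
  then show False
  proof cases
    case 1
    have "W \<subseteq> g ` under r b"
    proof
      fix w assume w: "w \<in> W"
      then have "w \<in> g ` under r \<xi>" using interior_subset by (auto simp: W_def V_def)
      then obtain x where "x \<in> under r \<xi>" "w = g x" by blast
      then show "w \<in> g ` under r b" using 1(2) disj w by blast
    qed
    then have "W \<subseteq> interior (g ` under r b)" using W(1) by (rule interior_maximal)
    then show False using least[OF 1(1)] W(2) F 1(1) by blast
  next
    case 2
    have "v \<in> g ` under r \<xi>" using v interior_subset by (auto simp: V_def)
    then show False using 2 disj W(2) by blast
  qed
qed

subsection \<open>Maps onto the Tikhonov cube\<close>

lemma uncountable_omega1: "uncountable omega1"
proof
  assume "countable omega1"
  then have "ordLeq3 (card_of omega1) (card_of (UNIV :: nat set))" 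
    unfolding card_of_ordLeq[symmetric] countable_def by simp
  moreover have "ordIso2 (card_of omega1) (cardSuc natLeq)"
    unfolding omega1_def by (rule card_of_Field_ordIso) (simp add: cardSuc_Card_order natLeq_Card_order)
  ultimately have "ordLeq3 (cardSuc natLeq) natLeq"
    using card_of_nat ordIso_ordLeq_trans ordIso_symmetric ordLeq_ordIso_trans by blast
  then show False
    using cardSuc_greater[OF natLeq_Card_order] not_ordLess_ordLeq by blast
qed

lemma topspace_cantor_space [simp]: "topspace cantor_space = UNIV"
  by (simp add: cantor_space_def)

lemma Hausdorff_cantor_space: "Hausdorff_space cantor_space"
  by (simp add: cantor_space_def Hausdorff_space_product_topology Hausdorff_space_discrete_topology)

lemma Hausdorff_tikhonov_cube_omega1: "Hausdorff_space tikhonov_cube_omega1"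
  by (simp add: tikhonov_cube_omega1_def Hausdorff_space_product_topology Hausdorff_space_subtopology)

lemma topspace_tikhonov_cube_omega1: "topspace tikhonov_cube_omega1 = PiE omega1 (\<lambda>_. {0..1})"
  by (simp add: tikhonov_cube_omega1_def)

text \<open>A bisection in the cube. If the points with a given initial part of \<open>f x\<close>
  have an image that covers a box fixing finitely many coordinates, then for one value of the next
  bit the image still covers a smaller such box. In the limit all bits but only countably many
  coordinates are fixed, and by compactness a coordinate left free takes all its values on the
  fiber.\<close>

lemma fiber_onto_interval:
  assumes comp: "compact_space K" and f: "continuous_map K cantor_space f"
    and g: "continuous_map K tikhonov_cube_omega1 g"
    and onto: "g ` topspace K = topspace tikhonov_cube_omega1"
  obtains t h where "continuous_map (subtopology K {x \<in> topspace K. f x = t}) euclideanreal h"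
    and "{0..1} \<subseteq> h ` {x \<in> topspace K. f x = t}"
proof -
  let ?Q = "tikhonov_cube_omega1" and ?I = "{0..1::real}"
  define box where "box S p = {y \<in> topspace ?Q. \<forall>i\<in>S. y i = p i}" for S :: "nat set set" and p :: "nat set \<Rightarrow> real"
  define C where "C t n = {x \<in> topspace K. \<forall>i<n. f x i = t i}" for t :: "nat \<Rightarrow> bool" and n :: nat
  have fi: "continuous_map K (discrete_topology UNIV) (\<lambda>x. f x i)" for i
    using f unfolding cantor_space_def by (simp add: continuous_map_componentwise_UNIV)
  have clC: "closedin K (C t n)" for t n
  proof -
    have "closedin K {x \<in> topspace K. f x i \<in> {t i}}" for i
      by (rule closedin_continuous_map_preimage[OF fi]) simp
    then have "closedin K (topspace K \<inter> (\<Inter>i\<in>{..<n}. {x \<in> topspace K. f x i \<in> {t i}}))"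
      by (cases "n = 0") (auto intro!: closedin_Int closedin_INT)
    also have "topspace K \<inter> (\<Inter>i\<in>{..<n}. {x \<in> topspace K. f x i \<in> {t i}}) = C t n"
      by (auto simp: C_def)
    finally show ?thesis .
  qed
  have clgC: "closedin ?Q (g ` C t n)" for t n
    using image_compactin[OF closedin_compact_space[OF comp clC] g] Hausdorff_tikhonov_cube_omega1
    by (rule compactin_imp_closedin[rotated])
  define inv where "inv n s \<longleftrightarrow> (case s of (S, p, t) \<Rightarrow>
    finite S \<and> S \<subseteq> omega1 \<and> p ` S \<subseteq> ?I \<and> box S p \<subseteq> g ` C t n)" for n s
  define ext where "ext n s s' \<longleftrightarrow> (case s of (S, p, t) \<Rightarrow> case s' of (S', p', t') \<Rightarrow>
    S \<subseteq> S' \<and> (\<forall>i\<in>S. p' i = p i) \<and> (\<forall>i<n. t' i = t i))"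
    for n :: nat and s s' :: "nat set set \<times> (nat set \<Rightarrow> real) \<times> (nat \<Rightarrow> bool)"
  have step: "\<exists>s'. inv (Suc n) s' \<and> ext n s s'" if "inv n s" for n s
  proof -
    obtain S p t where s: "s = (S, p, t)" by (metis surj_pair)
    have S: "finite S" "S \<subseteq> omega1" "p ` S \<subseteq> ?I" "box S p \<subseteq> g ` C t n"
      using that by (auto simp: inv_def s)
    define A where "A b = g ` C (t(n := b)) (Suc n)" for b
    have "C t n \<subseteq> C (t(n := True)) (Suc n) \<union> C (t(n := False)) (Suc n)"
      by (auto simp: C_def less_Suc_eq)
    then have cover: "box S p \<subseteq> A True \<union> A False" using S(4) unfolding A_def by blast
    show ?thesis
    proof (cases "box S p \<subseteq> A True")
      case True
      then show ?thesis
        using S by (intro exI[of _ "(S, p, t(n := True))"]) (auto simp: inv_def ext_def s A_def)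
    next
      case False
      \<comment> \<open>The image \<open>A True\<close> is closed, so a point \<open>y\<close> that
        it omits has a basic neighbourhood disjoint from it. Fixing the finitely many coordinates
        concerned to those of \<open>y\<close> leaves a box covered by
        \<open>A False\<close>.\<close>
      then obtain y where y: "y \<in> box S p" "y \<notin> A True" by blast
      have "openin ?Q (topspace ?Q - A True)" using clgC by (simp add: A_def openin_diff)
      moreover have "y \<in> topspace ?Q - A True" using y by (auto simp: box_def)
      ultimately obtain U where U: "finite {i \<in> omega1. U i \<noteq> ?I}" "y \<in> PiE omega1 U"
        "PiE omega1 U \<subseteq> topspace ?Q - A True"
        unfolding tikhonov_cube_omega1_def openin_product_topology_alt by (auto simp: Ball_def)
      define S' where "S' = S \<union> {i \<in> omega1. U i \<noteq> ?I}"
      have "box S' y \<subseteq> PiE omega1 U"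
      proof
        fix z assume z: "z \<in> box S' y"
        have "z i \<in> U i" if "i \<in> omega1" for i
          using z U(2) that by (cases "U i = ?I") (auto simp: box_def S'_def topspace_tikhonov_cube_omega1 PiE_iff)
        then show "z \<in> PiE omega1 U" using z by (auto simp: box_def topspace_tikhonov_cube_omega1 PiE_iff)
      qed
      moreover have "box S' y \<subseteq> box S p" using y(1) by (auto simp: box_def S'_def)
      ultimately have "box S' y \<subseteq> A False" using cover U(3) by blast
      moreover have "y ` S' \<subseteq> ?I" using y(1) S(2) by (auto simp: box_def S'_def topspace_tikhonov_cube_omega1)
      moreover have "\<forall>i\<in>S. y i = p i" using y(1) by (auto simp: box_def)
      ultimately show ?thesis
        using S U(1) by (intro exI[of _ "(S', y, t(n := False))"]) (auto simp: inv_def ext_def s A_def S'_def)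
    qed
  qed
  have "inv 0 ({}, \<lambda>_. 0, \<lambda>_. False)" using onto by (auto simp: inv_def box_def C_def)
  then obtain s where s: "\<And>n. inv n (s n)" "\<And>n. ext n (s n) (s (Suc n))"
    using dependent_nat_choice[of inv ext] step by blast
  define S where "S n = fst (s n)" for n
  define p where "p n = fst (snd (s n))" for n
  define t where "t n = snd (snd (s n))" for n
  have s_eq: "s n = (S n, p n, t n)" for n by (simp add: S_def p_def t_def)
  have I: "finite (S n)" "S n \<subseteq> omega1" "p n ` S n \<subseteq> ?I" "box (S n) (p n) \<subseteq> g ` C (t n) n" for n
    using s(1)[of n] by (auto simp: inv_def s_eq)
  have E: "S n \<subseteq> S (Suc n)" "\<And>i. i \<in> S n \<Longrightarrow> p (Suc n) i = p n i" "\<And>i. i < n \<Longrightarrow> t (Suc n) i = t n i" for n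
    using s(2)[of n] by (auto simp: ext_def s_eq)
  have mono: "S n \<subseteq> S (n + k)" for n k by (induction k) (use E(1) in auto)
  have pp: "p (n + k) i = p n i" if "i \<in> S n" for n k i
    using that mono[of n] by (induction k) (auto simp: E(2) subset_iff)
  have tt: "t (n + k) i = t n i" if "i < n" for n k i
    using that by (induction k) (auto simp: E(3))
  define p' where "p' i = p (LEAST n. i \<in> S n) i" for i
  have p': "p' i = p n i" if "i \<in> S n" for n i
  proof -
    have "i \<in> S (LEAST n. i \<in> S n)" "(LEAST n. i \<in> S n) \<le> n" using that by (auto intro: LeastI Least_le)
    then show ?thesis unfolding p'_def using pp[of i "LEAST n. i \<in> S n" "n - (LEAST n. i \<in> S n)"] by simp
  qed
  \<comment> \<open>Bit \<open>i\<close> is decided in step \<open>i\<close>, hence is final from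
    stage \<open>Suc i\<close> on.\<close>
  define t' where "t' i = t (Suc i) i" for i
  have t': "t n i = t' i" if "i < n" for n i
    using tt[of i "Suc i" "n - Suc i"] that by (simp add: t'_def)
  define R where "R = (\<Union>n. S n)"
  have "countable R" unfolding R_def using I(1) by (intro countable_UN) (auto intro: countable_finite)
  then have "omega1 - R \<noteq> {}" using uncountable_omega1 by (metis Diff_eq_empty_iff countable_subset)
  then obtain i0 where i0: "i0 \<in> omega1" "i0 \<notin> R" by blast
  define h where "h x = g x i0" for x
  have h: "continuous_map K euclideanreal h"
    using g i0(1) unfolding tikhonov_cube_omega1_def continuous_map_componentwise h_def
    by (auto simp: continuous_map_in_subtopology)
  show ?thesis
  proof (rule that)
    show "continuous_map (subtopology K {x \<in> topspace K. f x = t'}) euclideanreal h"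
      using h by (rule continuous_map_from_subtopology)
    show "{0..1} \<subseteq> h ` {x \<in> topspace K. f x = t'}"
    proof
      fix c :: real assume c: "c \<in> {0..1}"
      \<comment> \<open>The boxes constrain only coordinates in \<open>R\<close>; \<open>i0\<close>
        receives the prescribed value and the others an arbitrary 0.\<close>
      define y where "y = restrict (\<lambda>i. if i = i0 then c else if i \<in> R then p' i else 0) omega1"
      have "p' i \<in> ?I" if iR: "i \<in> R" for i
      proof -
        obtain n where "i \<in> S n" using iR unfolding R_def by blast
        then show ?thesis using I(3)[of n] p'[of i n] by (metis imageI subsetD)
      qed
      then have "(if i = i0 then c else if i \<in> R then p' i else 0) \<in> ?I" for i
        using c by simp
      then have yQ: "y \<in> topspace ?Q"
        unfolding topspace_tikhonov_cube_omega1 y_def restrict_PiE_iff by blast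
      have "y i = p n i" if "i \<in> S n" for n i
        using that i0 I(2)[of n] p'[OF that] by (auto simp: y_def R_def)
      then have "y \<in> box (S n) (p n)" for n using yQ by (simp add: box_def)
      then have ne: "{x \<in> topspace K. g x \<in> {y}} \<inter> C (t n) n \<noteq> {}" for n
        using I(4)[of n] unfolding C_def by blast
      have "closedin K ({x \<in> topspace K. g x \<in> {y}} \<inter> C (t n) n)" for n
        using clC closedin_continuous_map_preimage[OF g, of "{y}"] yQ
          Hausdorff_tikhonov_cube_omega1 by (auto simp: closedin_Hausdorff_singleton)
      moreover have "decseq (\<lambda>n. {x \<in> topspace K. g x \<in> {y}} \<inter> C (t n) n)"
        by (auto simp: decseq_def C_def t')
      ultimately have "(\<Inter>n. {x \<in> topspace K. g x \<in> {y}} \<inter> C (t n) n) \<noteq> {}"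
        using ne by (intro compact_space_imp_nest[OF comp]) auto
      then obtain x where x: "x \<in> topspace K" "g x = y" "\<And>n. x \<in> C (t n) n" by auto
      have "f x = t'"
      proof
        fix i show "f x i = t' i" using x(3)[of "Suc i"] by (simp add: C_def t'_def)
      qed
      moreover have "h x = c" using x(2) i0 by (simp add: h_def y_def)
      ultimately show "c \<in> h ` {x \<in> topspace K. f x = t'}" using x(1) by blast
    qed
  qed
qed

subsection \<open>Random transversals of a partition into blocks\<close>

text \<open>The blocks grow exponentially, so that a set with at most one element per block has a
  finite sum of densities. The number 0 belongs to no block.\<close>

definition blk :: "nat \<Rightarrow> nat set" where
  "blk n = {2^n..<2^Suc n}"

definition unif_blk :: "nat \<Rightarrow> nat measure" where
  "unif_blk n = measure_pmf (pmf_of_set (blk n))"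

definition blk_sum :: "nat measure" where
  "blk_sum = measure_of UNIV UNIV (\<lambda>A. \<Sum>n. emeasure (unif_blk n) A)"

definition transversals :: "(nat \<Rightarrow> nat) set" where
  "transversals = {z. \<forall>n. z n \<in> blk n}"

lemma blk_finite [simp]: "finite (blk n)" and blk_nonempty [simp]: "blk n \<noteq> {}"
  and card_blk [simp]: "card (blk n) = 2 ^ n"
  by (auto simp: blk_def)

lemma blk_disjoint: assumes "i \<in> blk m" "i \<in> blk n" shows "m = n"
proof (rule ccontr)
  assume "m \<noteq> n"
  then consider "Suc m \<le> n" | "Suc n \<le> m" by linarith
  then show False
  proof cases
    case 1
    then have "(2::nat) ^ Suc m \<le> 2 ^ n" by (rule power_increasing) simp
    then show False using assms unfolding blk_def by (meson atLeastLessThan_iff not_le order_trans)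
  next
    case 2
    then have "(2::nat) ^ Suc n \<le> 2 ^ m" by (rule power_increasing) simp
    then show False using assms unfolding blk_def by (meson atLeastLessThan_iff not_le order_trans)
  qed
qed

lemma blk_less: assumes "i \<in> blk n" "n < k" shows "i < 2 ^ k"
proof -
  have "i < 2 ^ Suc n" using assms(1) by (simp add: blk_def)
  also have "(2::nat) ^ Suc n \<le> 2 ^ k" using assms(2) by (intro power_increasing) auto
  finally show ?thesis .
qed

lemma blk_ge: assumes "i \<in> blk n" "k \<le> n" shows "2 ^ k \<le> i"
proof -
  have "(2::nat) ^ k \<le> 2 ^ n" using assms(2) by (intro power_increasing) auto
  also have "\<dots> \<le> i" using assms(1) by (simp add: blk_def)
  finally show ?thesis .
qed

lemma range_Int_blk: assumes "z \<in> transversals" shows "range z \<inter> blk n = {z n}"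
  using assms blk_disjoint unfolding transversals_def by blast

lemma sets_unif_blk [simp]: "sets (unif_blk n) = UNIV" and space_unif_blk [simp]: "space (unif_blk n) = UNIV"
  by (simp_all add: unif_blk_def)

lemma emeasure_unif_blk: "emeasure (unif_blk n) A = ennreal (real (card (blk n \<inter> A)) / 2 ^ n)"
  by (simp add: unif_blk_def emeasure_pmf_of_set)

lemma emeasure_unif_blk_cong: "blk n \<inter> A = blk n \<inter> B \<Longrightarrow> emeasure (unif_blk n) A = emeasure (unif_blk n) B"
  by (simp add: emeasure_unif_blk)

lemma sets_blk_sum [simp]: "sets blk_sum = UNIV"
  using sigma_algebra.sigma_sets_eq[OF sigma_algebra_Pow[of "UNIV :: nat set"]] by (simp add: blk_sum_def)

lemma emeasure_blk_sum: "emeasure blk_sum A = (\<Sum>n. emeasure (unif_blk n) A)"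
  unfolding blk_sum_def
proof (rule emeasure_measure_of_sigma)
  show "sigma_algebra UNIV (UNIV :: nat set set)"
    using sigma_algebra_Pow[of "UNIV :: nat set"] by simp
  show "positive UNIV (\<lambda>A. \<Sum>n. emeasure (unif_blk n) A)" by (simp add: positive_def)
  show "countably_additive UNIV (\<lambda>A. \<Sum>n. emeasure (unif_blk n) A)"
    unfolding countably_additive_def
  proof (intro allI impI)
    fix A :: "nat \<Rightarrow> nat set" assume dis: "disjoint_family A"
    \<comment> \<open>The sum over blocks is written as an integral for the counting measure, which
      commutes with the sum over \<open>i\<close>.\<close>
    have "(\<Sum>i. \<Sum>n. emeasure (unif_blk n) (A i))
        = (\<Sum>i. \<integral>\<^sup>+n. emeasure (unif_blk n) (A i) \<partial>count_space UNIV)"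
      by (simp add: nn_integral_count_space_nat)
    also have "\<dots> = (\<integral>\<^sup>+n. (\<Sum>i. emeasure (unif_blk n) (A i)) \<partial>count_space UNIV)"
      by (rule nn_integral_suminf[symmetric]) simp
    also have "\<dots> = (\<integral>\<^sup>+n. emeasure (unif_blk n) (\<Union>i. A i) \<partial>count_space UNIV)"
      using dis by (intro nn_integral_cong suminf_emeasure) auto
    finally show "(\<Sum>i. \<Sum>n. emeasure (unif_blk n) (A i)) = (\<Sum>n. emeasure (unif_blk n) (\<Union>i. A i))"
      by (simp add: nn_integral_count_space_nat)
  qed
qed simp

text \<open>A full block contributes 1 to the sum. Hence a set with sum below 1 leaves a point free
  in every block, which is how transversals avoiding it are found.\<close>

lemma blk_not_subset:
  assumes "emeasure blk_sum B < 1" shows "\<not> blk n \<subseteq> B"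
proof
  assume "blk n \<subseteq> B"
  then have "emeasure (unif_blk n) B = 1"
    by (simp add: emeasure_unif_blk Int_absorb2)
  moreover have "emeasure (unif_blk n) B \<le> emeasure blk_sum B"
    unfolding emeasure_blk_sum
    using sum_le_suminf[of "\<lambda>n. emeasure (unif_blk n) B" "{n}"] by simp
  ultimately show False using assms by simp
qed

text \<open>The sum is dominated by a geometric series. This puts the traces of points among the
  sets that the chain absorbs.\<close>

lemma at_most_one_per_blk:
  assumes "\<And>n. card (blk n \<inter> B) \<le> 1"
  shows "emeasure blk_sum B < \<infinity>"
proof -
  have "emeasure (unif_blk n) B \<le> ennreal ((1/2) ^ n)" for n
    unfolding emeasure_unif_blk using assms[of n] by (intro ennreal_leI) (simp add: power_divide divide_right_mono)
  then have "emeasure blk_sum B \<le> (\<Sum>n. ennreal ((1/2) ^ n))"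
    unfolding emeasure_blk_sum by (intro suminf_le) auto
  also have "\<dots> = ennreal 2"
    using geometric_sums[of "1/2::real"] by (intro suminf_ennreal_eq) auto
  finally show ?thesis by (auto intro: le_less_trans)
qed

lemma emeasure_blk_sum_singleton: "emeasure blk_sum {i} < \<infinity>"
proof (rule at_most_one_per_blk)
  show "card (blk n \<inter> {i}) \<le> 1" for n using card_mono[of "{i}" "blk n \<inter> {i}"] by simp
qed

lemma one_per_blk:
  assumes "\<And>n. \<exists>j. B \<inter> blk n = {j}"
  shows "emeasure blk_sum B < \<infinity>" "infinite B"
proof -
  have "card (blk n \<inter> B) \<le> 1" for n using assms[of n] by (auto simp: Int_commute)
  then show "emeasure blk_sum B < \<infinity>" by (rule at_most_one_per_blk)
  show "infinite B"
  proof
    assume "finite B"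
    then obtain k where k: "\<forall>i\<in>B. i < k" using finite_nat_set_iff_bounded by blast
    obtain j where "j \<in> B" "j \<in> blk k" using assms[of k] by blast
    then have "2 ^ k \<le> j" "j < k" using k by (auto simp: blk_def)
    then show False using less_exp[of k] by simp
  qed
qed

text \<open>The blocks from the \<open>k\<close>-th on lie in \<open>{2^k..}\<close>, so there
  \<open>blk_not_subset\<close> leaves room off \<open>B\<close>. Choices in different blocks are
  independent, so the beginning of \<open>z\<close> can be kept.\<close>

lemma transversal_extend:
  assumes z: "z \<in> transversals" and B: "emeasure blk_sum (B - {..<2^k}) < 1"
  obtains y where "y \<in> transversals" "\<And>n. n < k \<Longrightarrow> y n = z n" "\<And>n. k \<le> n \<Longrightarrow> y n \<notin> B"
proof -
  have "\<exists>j\<in>blk n. k \<le> n \<longrightarrow> j \<notin> B" for n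
    using blk_not_subset[OF B, of n] blk_ge[of _ n k] by (cases "k \<le> n") (force simp: subset_iff)+
  then obtain g where g: "\<And>n. g n \<in> blk n" "\<And>n. k \<le> n \<Longrightarrow> g n \<notin> B" by metis
  show ?thesis
    using z g by (intro that[of "\<lambda>n. if n < k then z n else g n"]) (auto simp: transversals_def)
qed

lemma range_below_power:
  assumes "z \<in> transversals" shows "range z \<inter> {..<2^k} = z ` {..<k}"
proof -
  have z: "z n \<in> blk n" for n using assms by (simp add: transversals_def)
  have "z n < 2 ^ k \<longleftrightarrow> n < k" for n
    using blk_less[OF z] blk_ge[OF z, of k n] by (metis not_le)
  then show ?thesis by auto
qed

abbreviation random_transversal :: "(nat \<Rightarrow> nat) measure" where
  "random_transversal \<equiv> PiM UNIV (\<lambda>n. unif_blk n)"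

lemma space_random_transversal [simp]: "space random_transversal = UNIV"
  by (simp add: space_PiM)

lemma sets_component: "{z. z n \<in> X} \<in> sets random_transversal"
proof -
  have "(\<lambda>z. z n) -` X \<inter> space random_transversal \<in> sets random_transversal"
    by (rule measurable_sets[OF measurable_component_singleton]) auto
  then show ?thesis by (simp add: vimage_def)
qed

lemma sets_components: "{z. \<forall>n. z n \<in> X n} \<in> sets random_transversal"
proof -
  have "(\<Inter>n. {z. z n \<in> X n}) \<in> sets random_transversal"
    by (intro sets.countable_INT') (auto simp: sets_component)
  moreover have "(\<Inter>n. {z. z n \<in> X n}) = {z. \<forall>n. z n \<in> X n}" by auto
  ultimately show ?thesis by simp
qed

lemma emeasure_components:
  assumes "finite J"
  shows "emeasure random_transversal {z. \<forall>n\<in>J. z n \<in> X n} = (\<Prod>n\<in>J. emeasure (unif_blk n) (X n))"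
proof -
  interpret product_prob_space "\<lambda>n. unif_blk n" UNIV
    by (rule product_prob_spaceI) (simp add: unif_blk_def prob_space_measure_pmf)
  show ?thesis using emeasure_PiM_Collect[of J X] assms by simp
qed

text \<open>A union bound relative to the event \<open>W\<close> of agreeing with \<open>z\<close>
  in the first \<open>k\<close> blocks. Given \<open>W\<close>, hitting \<open>B\<close> in a later
  block has by independence the density of \<open>B\<close> there as its probability, and these
  densities add up to less than 1.\<close>

lemma avoiding_transversals_pos:
  assumes z: "z \<in> transversals" and B: "emeasure blk_sum (B - {..<2^k}) < 1"
  shows "0 < emeasure random_transversal {y \<in> transversals. (\<forall>n<k. y n = z n) \<and> (\<forall>n\<ge>k. y n \<notin> B)}"
proof -
  let ?P = "emeasure random_transversal"
  define W where "W = {y :: nat \<Rightarrow> nat. \<forall>n\<in>{..<k}. y n \<in> {z n}}"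
  \<comment> \<open>The product space consists of all functions. Values outside the block, a null
    event, are put into \<open>N j\<close> so that what remains consists of transversals.\<close>
  define N where "N j = W \<inter> {y. y (j + k) \<in> B \<union> - blk (j + k)}" for j
  define \<delta> where "\<delta> = (\<Prod>n<k. emeasure (unif_blk n) {z n})"
  have zn: "z n \<in> blk n" for n using z by (simp add: transversals_def)
  have W: "?P W = \<delta>" unfolding W_def \<delta>_def by (rule emeasure_components) simp
  have "emeasure (unif_blk n) {z n} = ennreal (1 / 2 ^ n)" for n
    using zn[of n] by (simp add: emeasure_unif_blk)
  then have \<delta>: "\<delta> = ennreal (\<Prod>n<k. 1 / 2 ^ n)"
    unfolding \<delta>_def by (simp only:) (rule prod_ennreal, simp)
  then have d1: "\<delta> < \<infinity>" by simp
  have "0 < (\<Prod>n<k. 1 / 2 ^ n :: real)" by (intro prod_pos) simp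
  then have d0: "\<delta> \<noteq> 0" unfolding \<delta> by (simp add: ennreal_eq_0_iff)
  have N: "?P (N j) = \<delta> * emeasure (unif_blk (j + k)) (B - {..<2^k})" for j
  proof -
    define X where "X n = (if n = j + k then B \<union> - blk (j + k) else {z n})" for n
    have "N j = {y. \<forall>n\<in>insert (j + k) {..<k}. y n \<in> X n}"
      by (auto simp: N_def W_def X_def)
    then have "?P (N j) = (\<Prod>n\<in>insert (j + k) {..<k}. emeasure (unif_blk n) (X n))"
      by (simp only: emeasure_components finite_insert finite_lessThan)
    also have "\<dots> = emeasure (unif_blk (j + k)) (B \<union> - blk (j + k)) * \<delta>"
      by (subst prod.insert) (auto simp: X_def \<delta>_def intro!: arg_cong2[where f = "(*)"] prod.cong)
    also have "emeasure (unif_blk (j + k)) (B \<union> - blk (j + k)) = emeasure (unif_blk (j + k)) (B - {..<2^k})"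
      using blk_ge[of _ "j + k" k] by (intro emeasure_unif_blk_cong) force
    finally show ?thesis by (simp add: mult.commute)
  qed
  have "W = {y. \<forall>n. y n \<in> (if n < k then {z n} else UNIV)}" by (auto simp: W_def)
  then have Wm: "W \<in> sets random_transversal" by (simp only: sets_components)
  have Nm: "N j \<in> sets random_transversal" for j
    unfolding N_def by (intro sets.Int Wm sets_component)
  have "?P (\<Union>j. N j) \<le> (\<Sum>j. ?P (N j))"
    using Nm by (intro emeasure_subadditive_countably) auto
  also have "\<dots> = \<delta> * (\<Sum>j. emeasure (unif_blk (j + k)) (B - {..<2^k}))" by (simp add: N)
  also have "\<dots> \<le> \<delta> * emeasure blk_sum (B - {..<2^k})"
    unfolding emeasure_blk_sum
    using suminf_offset[of "\<lambda>n. emeasure (unif_blk n) (B - {..<2^k})" k] by (intro mult_left_mono) auto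
  also have "\<dots> < \<delta> * 1" using B d0 d1 by (intro ennreal_mult_strict_left_mono) (auto simp: zero_less_iff_neq_zero)
  finally have less: "?P (\<Union>j. N j) < ?P W" by (simp add: W)
  have U: "(\<Union>j. N j) \<in> sets random_transversal" using Nm by (intro sets.countable_UN) auto
  have "?P (W - (\<Union>j. N j)) + ?P (\<Union>j. N j) = ?P ((W - (\<Union>j. N j)) \<union> (\<Union>j. N j))"
    using Wm U by (intro plus_emeasure sets.Diff) auto
  also have "(W - (\<Union>j. N j)) \<union> (\<Union>j. N j) = W" unfolding N_def by blast
  finally have "?P W = ?P (W - (\<Union>j. N j)) + ?P (\<Union>j. N j)" by (rule sym)
  then have "0 < ?P (W - (\<Union>j. N j))" using less by (metis add_0 less_irrefl not_gr_zero)
  moreover have "W - (\<Union>j. N j) = {y \<in> transversals. (\<forall>n<k. y n = z n) \<and> (\<forall>n\<ge>k. y n \<notin> B)}"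
  proof -
    have "y \<in> W - (\<Union>j. N j) \<longleftrightarrow> (\<forall>n<k. y n = z n) \<and> (\<forall>n\<ge>k. y n \<in> blk n \<and> y n \<notin> B)" for y
      unfolding N_def W_def by (auto dest: le_Suc_ex simp: le_iff_add add.commute)
    then show ?thesis using zn by (auto simp: transversals_def) (metis not_le)+
  qed
  ultimately show ?thesis by simp
qed

subsection \<open>The space built from a chain\<close>

text \<open>The points of the space will be sets of indices, so the index type \<open>'i\<close> is
  kept open to meet a prescribed point type. \<open>p\<close> and \<open>q\<close> pick indices for
  the singletons and for the tails of the chain; \<open>D_cases\<close> bars other generators but
  lets one set have many indices.\<close>

locale slalom_chain =
  fixes r :: "'c rel" and A :: "'c \<Rightarrow> nat set"
    and D :: "'i \<Rightarrow> nat set" and p :: "nat \<Rightarrow> 'i" and q :: "'c \<Rightarrow> nat \<Rightarrow> 'i"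
  assumes wo: "Well_order r" and Field_r: "Field r = UNIV"
    and A_finite: "\<And>a. emeasure blk_sum (A a) < \<infinity>"
    and A_chain: "\<And>a b. (b, a) \<in> r \<Longrightarrow> finite (A b - A a)"
    and A_cofinal: "\<And>B. emeasure blk_sum B < \<infinity> \<Longrightarrow> \<exists>a. B \<subseteq> A a"
    and D_p: "\<And>i. D (p i) = {i}"
    and D_q: "\<And>a m. D (q a m) = A a - {..<m}"
    and D_cases: "\<And>c. (\<exists>i. D c = {i}) \<or> (\<exists>a m. D c = A a - {..<m})"
begin

definition gen :: "'i \<Rightarrow> (nat \<Rightarrow> nat) set" where
  "gen c = {z \<in> transversals. range z \<inter> D c = {}}"

abbreviation "pts \<equiv> realized transversals gen"
abbreviation "K \<equiv> type_space transversals gen"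

text \<open>\<open>p i \<in> x\<close> says that \<open>x\<close> avoids \<open>i\<close>, so this
  is the transversal induced by \<open>x\<close>, as the set of its values.\<close>

definition trace :: "'i set \<Rightarrow> nat set" where
  "trace x = {i. p i \<notin> x}"

text \<open>The dividing line between the sets of the chain that \<open>x\<close> almost avoids and
  the others. Within \<open>underS_cut\<close> it is shown to exist for points of the space, so the
  choice is not vacuous.\<close>

definition cut :: "'i set \<Rightarrow> 'c" where
  "cut x = (SOME a. (\<forall>m. q a m \<notin> x) \<and> (\<forall>b\<in>underS r a. \<exists>m. q b m \<in> x))"

section \<open>Points as pairs of a trace and a cut\<close>

text \<open>Adding the indices \<open>p i\<close> for \<open>i < m\<close> to \<open>F\<close> makes
  the realizing transversal copy the trace below \<open>m\<close>.\<close>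

lemma realizer:
  assumes x: "x \<in> pts" and F: "finite F"
  shows "\<exists>z\<in>transversals. (\<forall>c\<in>F. c \<in> x \<longleftrightarrow> range z \<inter> D c = {}) \<and> (\<forall>i<m. i \<in> range z \<longleftrightarrow> i \<in> trace x)"
proof -
  have "finite (F \<union> p ` {..<m})" using F by simp
  then obtain z where z: "z \<in> transversals" "\<And>c. c \<in> F \<union> p ` {..<m} \<Longrightarrow> c \<in> x \<longleftrightarrow> z \<in> gen c"
    using realizedE[OF x] by metis
  show ?thesis
  proof (intro bexI[OF _ z(1)] conjI ballI allI impI)
    show "c \<in> x \<longleftrightarrow> range z \<inter> D c = {}" if "c \<in> F" for c
      using z(1) z(2)[of c] that by (simp add: gen_def)
    show "i \<in> range z \<longleftrightarrow> i \<in> trace x" if "i < m" for i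
      using z(1) z(2)[of "p i"] that by (simp add: gen_def trace_def D_p)
  qed
qed

lemma trace_Int_blk: assumes "x \<in> pts" shows "\<exists>j. trace x \<inter> blk n = {j}"
proof -
  obtain z where z: "z \<in> transversals" "\<And>i. i < 2 ^ Suc n \<Longrightarrow> i \<in> range z \<longleftrightarrow> i \<in> trace x"
    using realizer[OF assms finite.emptyI] by metis
  have "trace x \<inter> blk n = range z \<inter> blk n" using z(2) blk_less[of _ n "Suc n"] by blast
  then show ?thesis using range_Int_blk[OF z(1)] by auto
qed

lemma trace_Int_D: assumes x: "x \<in> pts" and c: "c \<in> x" shows "trace x \<inter> D c = {}"
proof (rule ccontr)
  assume "trace x \<inter> D c \<noteq> {}"
  then obtain i where i: "i \<in> trace x" "i \<in> D c" by blast
  have "finite {c}" by simp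
  from realizer[OF x this, of "Suc i"]
  obtain z :: "nat \<Rightarrow> nat" where "\<forall>d\<in>{c}. d \<in> x \<longleftrightarrow> range z \<inter> D d = {}" "\<forall>j<Suc i. j \<in> range z \<longleftrightarrow> j \<in> trace x"
    by blast
  then have "range z \<inter> D c = {}" "i \<in> range z" using c i(1) by auto
  then show False using i(2) by blast
qed

text \<open>Below \<open>m\<close> the trace decides, above \<open>m\<close> avoiding \<open>D c\<close> does.\<close>

lemma mem_upward:
  assumes x: "x \<in> pts" and c: "c \<in> x"
    and sub: "D c' - {..<m} \<subseteq> D c" and tr: "trace x \<inter> D c' \<inter> {..<m} = {}"
  shows "c' \<in> x"
proof -
  have "finite {c, c'}" by simp
  from realizer[OF x this, of m] obtain z :: "nat \<Rightarrow> nat" where "\<forall>d\<in>{c, c'}. d \<in> x \<longleftrightarrow> range z \<inter> D d = {}"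
    and tr_z: "\<forall>i<m. i \<in> range z \<longleftrightarrow> i \<in> trace x"
    by blast
  then have z: "c \<in> x \<longleftrightarrow> range z \<inter> D c = {}" "c' \<in> x \<longleftrightarrow> range z \<inter> D c' = {}" by simp_all
  have "range z \<inter> D c = {}" using z(1) c by simp
  have "i \<notin> D c'" if "i \<in> range z" for i
  proof (cases "i < m")
    case True then show ?thesis using tr_z True tr that by blast
  next
    case False then show ?thesis using \<open>range z \<inter> D c = {}\<close> sub that by auto
  qed
  then show ?thesis using z(2) by blast
qed

text \<open>The trace is infinite, but by cofinality of the chain some \<open>A a\<close> contains
  all of it. Avoiding a tail of that \<open>A a\<close> would make the trace finite.\<close>

lemma not_in_cut_exists: assumes x: "x \<in> pts" shows "\<exists>a. \<forall>m. q a m \<notin> x"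
proof -
  have t: "emeasure blk_sum (trace x) < \<infinity>" "infinite (trace x)"
    using one_per_blk trace_Int_blk[OF x] by auto
  obtain a where a: "trace x \<subseteq> A a" using A_cofinal[OF t(1)] by blast
  have "q a m \<notin> x" for m
  proof
    assume "q a m \<in> x"
    then have "trace x \<inter> (A a - {..<m}) = {}" using trace_Int_D[OF x] D_q by metis
    then have "trace x \<subseteq> {..<m}" using a by blast
    then show False using t(2) finite_subset by blast
  qed
  then show ?thesis by blast
qed

text \<open>The indices almost avoided by \<open>x\<close> form a proper initial segment: proper by
  \<open>not_in_cut_exists\<close>, and closed downwards because earlier sets of the chain are
  almost contained in later ones.\<close>

lemma underS_cut: assumes x: "x \<in> pts" shows "a \<in> underS r (cut x) \<longleftrightarrow> (\<exists>m. q a m \<in> x)"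
proof -
  note W = Well_orderD[OF wo]
  define N where "N = {a. \<forall>m. q a m \<notin> x}"
  obtain a0 where "a0 \<in> N" using not_in_cut_exists[OF x] by (auto simp: N_def)
  have "wf (r - Id)" using wo by (simp add: well_order_on_def)
  then obtain a1 where "a1 \<in> N" "\<And>b. (b, a1) \<in> r - Id \<Longrightarrow> b \<notin> N"
    using wfE_min[OF _ \<open>a0 \<in> N\<close>] by metis
  then have "\<exists>a. (\<forall>m. q a m \<notin> x) \<and> (\<forall>b\<in>underS r a. \<exists>m. q b m \<in> x)"
    unfolding N_def underS_def by auto
  from someI_ex[OF this, folded cut_def]
  have cut: "\<forall>m. q (cut x) m \<notin> x" "\<forall>b\<in>underS r (cut x). \<exists>m. q b m \<in> x" by simp_all
  show ?thesis
  proof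
    assume "a \<in> underS r (cut x)" then show "\<exists>m. q a m \<in> x" using cut(2) by blast
  next
    assume "\<exists>m. q a m \<in> x"
    then obtain m where m: "q a m \<in> x" by blast
    show "a \<in> underS r (cut x)"
    proof (rule ccontr)
      assume "a \<notin> underS r (cut x)"
      then have "(cut x, a) \<in> r" using W(1,4)[of "cut x"] Field_r unfolding underS_def by blast
      then have "finite (A (cut x) - A a)" by (rule A_chain)
      then obtain k where k: "\<forall>i\<in>A (cut x) - A a. i < k"
        unfolding finite_nat_set_iff_bounded ..
      \<comment> \<open>Starting the tail at \<open>max k m\<close> discards the finite exceptional
        part, which turns almost inclusion into inclusion.\<close>
      have "D (q (cut x) (max k m)) - {..<0} \<subseteq> D (q a m)"
      proof
        fix i assume "i \<in> D (q (cut x) (max k m)) - {..<0}"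
        then have i: "i \<in> A (cut x)" "k \<le> i" "m \<le> i" by (auto simp: D_q)
        then have "i \<in> A a" using k by (meson DiffI leD)
        then show "i \<in> D (q a m)" using i by (simp add: D_q)
      qed
      then have "q (cut x) (max k m) \<in> x" by (rule mem_upward[OF x m]) simp
      then show False using cut(1) by blast
    qed
  qed
qed

text \<open>The trace decides the generators given by singletons. For a tail of \<open>A a\<close>
  the cut tells whether some tail of \<open>A a\<close> is avoided, and the trace settles the
  finitely many elements by which tails differ.\<close>

lemma inj_on_trace_cut:
  assumes x: "x \<in> pts" and y: "y \<in> pts" and tr: "trace x = trace y" and cut: "cut x = cut y"
  shows "x = y"
proof -
  have "c \<in> y'" if x': "x' \<in> pts" and y': "y' \<in> pts" and tr: "trace x' = trace y'"
    and cut: "cut x' = cut y'" and c: "c \<in> x'" for c x' y'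
  proof -
    consider i where "D c = {i}" | a m where "D c = A a - {..<m}" using D_cases by blast
    then show ?thesis
    proof cases
      case 1
      then have "i \<notin> trace y'" using trace_Int_D[OF x' c] tr by auto
      then have "p i \<in> y'" by (simp add: trace_def)
      then show ?thesis by (rule mem_upward[OF y', of _ _ 0]) (simp_all add: 1 D_p)
    next
      case 2
      then have "q a m \<in> x'" by (intro mem_upward[OF x' c, of _ 0]) (simp_all add: D_q)
      then have "a \<in> underS r (cut y')" using underS_cut[OF x'] cut by auto
      then obtain m' where m': "q a m' \<in> y'" using underS_cut[OF y'] by blast
      have "trace y' \<inter> D c = {}" using trace_Int_D[OF x' c] tr by simp
      moreover have "D c - {..<m'} \<subseteq> D (q a m')" using 2 by (auto simp: D_q)
      ultimately show ?thesis using mem_upward[OF y' m'] by blast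
    qed
  qed
  then show ?thesis using assms by (metis subsetI subset_antisym)
qed

section \<open>The map to the Cantor space and its fibers\<close>

lemma continuous_trace: "continuous_map K cantor_space (\<lambda>x i. i \<in> trace x)"
  unfolding cantor_space_def continuous_map_componentwise_UNIV
proof
  fix i
  show "continuous_map K (discrete_topology UNIV) (\<lambda>x. i \<in> trace x)"
    unfolding continuous_map_def
  proof (intro conjI allI impI)
    fix U :: "bool set"
    show "openin K {x \<in> topspace K. (i \<in> trace x) \<in> U}"
    proof (rule openin_type_space_determined[of "{p i}"])
      fix x y assume x: "x \<in> {x \<in> topspace K. (i \<in> trace x) \<in> U}" and y: "y \<in> pts"
        and eq: "y \<inter> {p i} = x \<inter> {p i}"
      have "p i \<in> y \<longleftrightarrow> p i \<in> x" using eq by blast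
      then show "y \<in> {x \<in> topspace K. (i \<in> trace x) \<in> U}" using x y by (simp add: trace_def)
    qed auto
  qed simp
qed

lemma compact_fiber: "compact_space (subtopology K {x \<in> topspace K. (\<lambda>i. i \<in> trace x) = t})"
proof -
  have "closedin K {x \<in> topspace K. (\<lambda>i. i \<in> trace x) \<in> {t}}"
    by (rule closedin_continuous_map_preimage[OF continuous_trace])
      (simp add: closedin_Hausdorff_singleton Hausdorff_cantor_space)
  then have "closedin K {x \<in> topspace K. (\<lambda>i. i \<in> trace x) = t}" by simp
  then show ?thesis
    using compact_type_space closedin_compact_space compact_space_subtopology by blast
qed

text \<open>The coordinate is \<open>cut\<close>. That it exceeds \<open>a\<close> is an open
  condition, a union over \<open>m\<close>. The complementary condition is open as well over a fixed
  trace: either the trace meets every tail of \<open>A a\<close> and the cut never exceeds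
  \<open>a\<close>, or it misses the tail from some \<open>m\<close> on and then
  \<open>q a m\<close> alone decides.\<close>

lemma fiber_homeomorphic_to_ordinal:
  "homeomorphic_to_ordinal (subtopology K {x \<in> topspace K. (\<lambda>i. i \<in> trace x) = t})"
proof -
  define S where "S = {x \<in> pts. (\<lambda>i. i \<in> trace x) = t}"
  let ?X = "subtopology K S"
  have tpX: "topspace ?X = S" by (auto simp: S_def)
  have S: "x \<in> pts" "trace x = Collect t" if "x \<in> S" for x using that by (auto simp: S_def)
  have comp: "compact_space ?X" using compact_fiber[of t] by (simp add: S_def)
  have op: "openin ?X (S \<inter> {x \<in> pts. c \<in> x})" "openin ?X (S \<inter> {x \<in> pts. c \<notin> x})" for c
    by (rule openin_subtopology_Int2, rule openin_type_space_mem)+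
  have "homeomorphic_to_ordinal ?X"
  proof (rule compact_homeomorphic_to_ordinal[OF comp wo Field_r])
    show "inj_on cut (topspace ?X)" unfolding tpX by (intro inj_onI) (metis S inj_on_trace_cut)
    fix a
    have up: "cut x \<in> aboveS r a \<longleftrightarrow> (\<exists>m. q a m \<in> x)" if "x \<in> S" for x
      using underS_cut[OF S(1)[OF that], of a] by (auto simp: aboveS_def underS_def)
    have "{x \<in> topspace ?X. cut x \<in> aboveS r a} = (\<Union>m. S \<inter> {x \<in> pts. q a m \<in> x})"
      unfolding tpX using up S(1) by blast
    moreover have "openin ?X (\<Union>m. S \<inter> {x \<in> pts. q a m \<in> x})" using op(1) by (intro openin_Union) blast
    ultimately show "openin ?X {x \<in> topspace ?X. cut x \<in> aboveS r a}" by (simp only:)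
    have down: "cut x \<in> under r a \<longleftrightarrow> (\<forall>m. q a m \<notin> x)" if "x \<in> S" for x
      using up[OF that] Well_orderD(1,3)[OF wo, of a "cut x"] Well_orderD(4)[OF wo, of a] Field_r
      unfolding aboveS_def under_def by blast
    show "openin ?X {x \<in> topspace ?X. cut x \<in> under r a}"
    proof (cases "\<exists>m. Collect t \<inter> (A a - {..<m}) = {}")
      case True
      then obtain m where m: "Collect t \<inter> (A a - {..<m}) = {}" by blast
      have eq: "cut x \<in> under r a \<longleftrightarrow> q a m \<notin> x" if x: "x \<in> S" for x
      proof -
        have "q a m \<in> x" if "q a m' \<in> x" for m'
        proof (rule mem_upward[OF S(1)[OF x] that])
          show "D (q a m) - {..<m'} \<subseteq> D (q a m')" by (auto simp: D_q)
          show "trace x \<inter> D (q a m) \<inter> {..<m'} = {}" using m unfolding S(2)[OF x] D_q by blast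
        qed
        then show ?thesis using down[OF x] by blast
      qed
      have "{x \<in> topspace ?X. cut x \<in> under r a} = S \<inter> {x \<in> pts. q a m \<notin> x}"
        unfolding tpX using eq S(1) by auto
      then show ?thesis using op(2) by (simp only:)
    next
      case False
      have "q a m \<notin> x" if x: "x \<in> S" for x m
      proof
        assume "q a m \<in> x"
        then have "Collect t \<inter> (A a - {..<m}) = {}"
          using trace_Int_D[OF S(1)[OF x]] S(2)[OF x] D_q by metis
        then show False using False by blast
      qed
      then have "{x \<in> topspace ?X. cut x \<in> under r a} = topspace ?X"
        unfolding tpX using down by blast
      then show ?thesis by (metis openin_topspace)
    qed
  qed
  then show ?thesis by (simp add: S_def)
qed

text \<open>
  A basic neighbourhood of \<open>x\<close> is witnessed by one transversal, and it contains every transversal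
  that agrees with the witness below \<open>m'\<close> and avoids \<open>B\<close> from there on.
\<close>

lemma local_shape:
  assumes x: "x \<in> pts" and F: "finite F"
  obtains B z m where "emeasure blk_sum B < \<infinity>" "finite (B - A (cut x))" "z \<in> transversals"
    "range z \<inter> B = {}"
    "\<And>m' z'. m \<le> m' \<Longrightarrow> z' \<in> transversals \<Longrightarrow> range z' \<inter> {..<m'} = range z \<inter> {..<m'} \<Longrightarrow>
      range z' \<inter> (B - {..<m'}) = {} \<Longrightarrow> (\<forall>c\<in>F. c \<in> x \<longleftrightarrow> range z' \<inter> D c = {})"
proof -
  \<comment> \<open>\<open>B\<close> collects what \<open>x\<close> is bound to avoid: singletons
    and tails of sets \<open>A a\<close> with \<open>a\<close> below the cut. Hence it is almost
    contained in \<open>A (cut x)\<close>.\<close>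
  define B where "B = (\<Union>c\<in>F \<inter> x. D c)"
  have fD: "emeasure blk_sum (D c) < \<infinity> \<and> finite (D c - A (cut x))" if c: "c \<in> x" for c
  proof -
    consider i where "D c = {i}" | a k where "D c = A a - {..<k}" using D_cases by blast
    then show ?thesis
    proof cases
      case 1
      then show ?thesis using emeasure_blk_sum_singleton[of i] by (simp add: D_p)
    next
      case 2
      then have "q a k \<in> x" by (intro mem_upward[OF x c, of _ 0]) (simp_all add: D_q)
      then have "(a, cut x) \<in> r" using underS_cut[OF x, of a] by (auto simp: underS_def)
      then have "finite (A a - A (cut x))" by (rule A_chain)
      then have "finite (D c - A (cut x))" by (rule finite_subset[rotated]) (auto simp: 2)
      moreover have "emeasure blk_sum (D c) \<le> emeasure blk_sum (A a)"
        by (intro emeasure_mono) (auto simp: 2)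
      ultimately show ?thesis using A_finite[of a] by (auto intro: le_less_trans)
    qed
  qed
  have "emeasure blk_sum B \<le> (\<Sum>c\<in>F \<inter> x. emeasure blk_sum (D c))"
    unfolding B_def using F by (intro emeasure_subadditive_finite) auto
  also have "\<dots> < \<infinity>" using fD F by (simp add: less_top[symmetric])
  finally have B1: "emeasure blk_sum B < \<infinity>" .
  have "B - A (cut x) = (\<Union>c\<in>F \<inter> x. D c - A (cut x))" by (auto simp: B_def)
  moreover have "finite (\<Union>c\<in>F \<inter> x. D c - A (cut x))" using fD F by (intro finite_UN_I) auto
  ultimately have B2: "finite (B - A (cut x))" by (simp only:)
  obtain z where z: "z \<in> transversals" "\<And>c. c \<in> F \<Longrightarrow> c \<in> x \<longleftrightarrow> range z \<inter> D c = {}"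
    using realizer[OF x F] by metis
  have "\<exists>i. i \<in> range z \<inter> D c" if "c \<in> F - x" for c using z(2)[of c] that by blast
  \<comment> \<open>For \<open>c \<notin> x\<close> the witness \<open>z\<close> hits
    \<open>D c\<close> at \<open>w c\<close>. Agreement with \<open>z\<close> below a bound
    \<open>m\<close> for these finitely many numbers preserves the hits.\<close>
  then obtain w where w: "\<And>c. c \<in> F - x \<Longrightarrow> w c \<in> range z \<inter> D c" by metis
  have "finite (w ` (F - x))" using F by simp
  then obtain m where "\<forall>i\<in>w ` (F - x). i < m" unfolding finite_nat_set_iff_bounded ..
  then have m: "\<And>c. c \<in> F - x \<Longrightarrow> w c < m" by blast
  show ?thesis
  proof (rule that[OF B1 B2 z(1)])
    show "range z \<inter> B = {}" unfolding B_def using z(2) by blast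
    fix m' z' assume m': "m \<le> m'" and z': "z' \<in> transversals"
      and eq: "range z' \<inter> {..<m'} = range z \<inter> {..<m'}" and B: "range z' \<inter> (B - {..<m'}) = {}"
    show "\<forall>c\<in>F. c \<in> x \<longleftrightarrow> range z' \<inter> D c = {}"
    proof
      fix c assume c: "c \<in> F"
      show "c \<in> x \<longleftrightarrow> range z' \<inter> D c = {}"
      proof (cases "c \<in> x")
        case True
        then have "D c \<subseteq> B" "range z \<inter> D c = {}" using c z(2) by (auto simp: B_def)
        then have "range z' \<inter> D c = {}" using eq B by blast
        then show ?thesis using True by simp
      next
        case False
        then have "w c \<in> range z" "w c \<in> D c" "w c \<in> {..<m'}" using w[of c] m[of c] m' c by auto
        then have "w c \<in> range z' \<inter> D c" using eq by blast
        then show ?thesis using False by blast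
      qed
    qed
  qed
qed

section \<open>Non-separability, \<pi>-character and measure\<close>

lemma not_separable:
  assumes ub: "\<And>\<F>. countable \<F> \<Longrightarrow> (\<And>B. B \<in> \<F> \<Longrightarrow> emeasure blk_sum B < \<infinity>) \<Longrightarrow>
    \<exists>C. emeasure blk_sum C < \<infinity> \<and> (\<forall>B\<in>\<F>. finite (B - C))"
  shows "\<not> separable_space K"
proof
  assume "separable_space K"
  then obtain S where S: "countable S" "S \<subseteq> pts" "K closure_of S = pts"
    unfolding separable_space_def by auto
  have t: "emeasure blk_sum (trace x) < \<infinity>" "infinite (trace x)" if "x \<in> pts" for x
    using one_per_blk trace_Int_blk[OF that] by auto
  have "\<exists>C. emeasure blk_sum C < \<infinity> \<and> (\<forall>B\<in>trace ` S. finite (B - C))"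
    by (rule ub) (use S t(1) in auto)
  then obtain C where C: "emeasure blk_sum C < \<infinity>" "\<And>x. x \<in> S \<Longrightarrow> finite (trace x - C)" by blast
  obtain a where a: "C \<subseteq> A a" using A_cofinal[OF C(1)] by blast
  obtain k where k: "emeasure blk_sum (A a - {..<k}) < 1"
    using emeasure_tail_less[OF sets_blk_sum A_finite] by (metis zero_less_one)
  define U where "U = {x \<in> pts. q a k \<in> x}"
  have "openin K U" unfolding U_def by (rule openin_type_space_mem)
  \<comment> \<open>Nonemptiness of \<open>U\<close>: a tail with sum below 1 leaves a free point in
    every block.\<close>
  obtain z where z: "z \<in> transversals" "\<And>n. z n \<notin> A a - {..<k}"
  proof -
    have "\<exists>j\<in>blk n. j \<notin> A a - {..<k}" for n using blk_not_subset[OF k, of n] by blast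
    then obtain g where "\<And>n. g n \<in> blk n" "\<And>n. g n \<notin> A a - {..<k}" by metis
    then show ?thesis using that[of g] by (simp add: transversals_def)
  qed
  have "principal_type gen z \<in> U"
    using z principal_type_realized[OF z(1), of gen] by (auto simp: U_def principal_type_def gen_def D_q)
  moreover from this have "principal_type gen z \<in> K closure_of S" unfolding S(3) U_def by simp
  ultimately obtain x where x: "x \<in> S" "x \<in> U"
    using \<open>openin K U\<close> unfolding in_closure_of by blast
  have "x \<in> pts" using x by (simp add: U_def)
  have "trace x \<inter> (A a - {..<k}) = {}" using trace_Int_D[OF \<open>x \<in> pts\<close>, of "q a k"] x by (simp add: U_def D_q)
  \<comment> \<open>The trace is almost inside \<open>C\<close>, yet meets \<open>C\<close> only
    below \<open>k\<close>; this makes it finite.\<close>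
  then have "trace x \<subseteq> (trace x - C) \<union> {..<k}" using a by auto
  moreover have "finite ((trace x - C) \<union> {..<k})" using C(2)[OF x(1)] by simp
  ultimately have "finite (trace x)" by (rule finite_subset)
  then show False using t(2)[OF \<open>x \<in> pts\<close>] by blast
qed

text \<open>What a basic neighbourhood of \<open>x\<close> requires to be avoided is almost inside
  \<open>A (cut x)\<close>, so it is enough to avoid a tail of this one set and to fix a suitable
  trace below it. Only \<open>m\<close> and a finite set \<open>s\<close> vary, hence countability.
  The point \<open>x\<close> itself avoids no tail of \<open>A (cut x)\<close>, so it lies in none
  of these sets.\<close>

lemma countable_pi_character_K: "countable_pi_character K"
  unfolding countable_pi_character_def
proof
  fix x assume "x \<in> topspace K"
  then have x: "x \<in> pts" by simp
  define U where "U s m = {y \<in> pts. q (cut x) m \<in> y \<and> trace y \<inter> {..<m} = s}" for s m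
  define \<P> where "\<P> = {U s m | s m. finite s \<and> U s m \<noteq> {}}"
  have "countable ((\<lambda>(s, m). U s m) ` ({s. finite s} \<times> UNIV))"
    by (intro countable_image countable_SIGMA countable_Collect_finite) auto
  then have "countable \<P>" by (rule countable_subset[rotated]) (auto simp: \<P>_def)
  moreover have "pi_base_at K x \<P>"
    unfolding pi_base_at_def
  proof (intro conjI ballI allI impI)
    fix V assume "V \<in> \<P>"
    then obtain s m where V: "V = U s m" "V \<noteq> {}" by (auto simp: \<P>_def)
    have "openin K (U s m)"
    proof (rule openin_type_space_determined[of "insert (q (cut x) m) (p ` {..<m})"])
      fix y y' assume y: "y \<in> U s m" "y' \<in> pts"
        and eq: "y' \<inter> insert (q (cut x) m) (p ` {..<m}) = y \<inter> insert (q (cut x) m) (p ` {..<m})"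
      have "q (cut x) m \<in> y'" using eq y(1) by (auto simp: U_def)
      moreover have "i \<in> trace y' \<longleftrightarrow> i \<in> trace y" if "i < m" for i
        using eq that unfolding trace_def by blast
      ultimately show "y' \<in> U s m" using y by (auto simp: U_def)
    qed (auto simp: U_def)
    then show "openin K V" "V \<noteq> {}" using V by auto
  next
    fix V assume V: "openin K V \<and> x \<in> V"
    then obtain F where F: "finite F" "cyl transversals gen F x \<subseteq> V"
      unfolding openin_type_space by blast
    obtain B z m where B: "emeasure blk_sum B < \<infinity>" "finite (B - A (cut x))" "z \<in> transversals"
      "range z \<inter> B = {}"
      "\<And>m' z'. m \<le> m' \<Longrightarrow> z' \<in> transversals \<Longrightarrow> range z' \<inter> {..<m'} = range z \<inter> {..<m'} \<Longrightarrow>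
        range z' \<inter> (B - {..<m'}) = {} \<Longrightarrow> (\<forall>c\<in>F. c \<in> x \<longleftrightarrow> range z' \<inter> D c = {})"
      by (rule local_shape[OF x F(1)]) blast
    obtain m1 where m1: "\<forall>i\<in>B - A (cut x). i < m1"
      using B(2) unfolding finite_nat_set_iff_bounded ..
    obtain k where k: "k \<ge> max m m1" "emeasure blk_sum (A (cut x) - {..<k}) < 1"
      using emeasure_tail_less[OF sets_blk_sum A_finite] by (metis zero_less_one)
    \<comment> \<open>\<open>{..<2 ^ k}\<close> contains the blocks before the \<open>k\<close>-th
      and meets no other, so fixing a trace below \<open>n\<close> is fixing the first
      \<open>k\<close> choices of a transversal. As \<open>k < n\<close>, the earlier bounds
      persist.\<close>
    define n where "n = (2::nat) ^ k"
    have kn: "k < n" by (simp add: n_def)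
    have "emeasure blk_sum (A (cut x) - {..<n}) \<le> emeasure blk_sum (A (cut x) - {..<k})"
      using kn by (intro emeasure_mono) auto
    then have An: "emeasure blk_sum (A (cut x) - {..<2^k}) < 1"
      using k(2) by (simp add: n_def)
    have sub: "U (range z \<inter> {..<n}) n \<subseteq> V"
    proof
      fix y assume "y \<in> U (range z \<inter> {..<n}) n"
      then have y: "y \<in> pts" "q (cut x) n \<in> y" "trace y \<inter> {..<n} = range z \<inter> {..<n}"
        by (auto simp: U_def)
      obtain z' where z': "z' \<in> transversals"
        "\<And>c. c \<in> insert (q (cut x) n) F \<Longrightarrow> c \<in> y \<longleftrightarrow> range z' \<inter> D c = {}"
        "\<And>i. i < n \<Longrightarrow> i \<in> range z' \<longleftrightarrow> i \<in> trace y"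
        using realizer[OF y(1), of "insert (q (cut x) n) F" n] F(1) by (metis finite.insertI)
      have "range z' \<inter> (A (cut x) - {..<n}) = {}" using z'(2)[of "q (cut x) n"] y(2) by (simp add: D_q)
      moreover have "B - {..<n} \<subseteq> A (cut x) - {..<n}"
      proof
        fix i assume i: "i \<in> B - {..<n}"
        then have "m1 \<le> i" using k(1) kn by auto
        then have "i \<in> A (cut x)" using m1 i by (meson DiffD1 DiffI leD)
        then show "i \<in> A (cut x) - {..<n}" using i by blast
      qed
      ultimately have "range z' \<inter> (B - {..<n}) = {}" by blast
      moreover have "range z' \<inter> {..<n} = range z \<inter> {..<n}" using z'(3) y(3) by auto
      ultimately have "\<forall>c\<in>F. c \<in> x \<longleftrightarrow> range z' \<inter> D c = {}"
        using k(1) kn z'(1) by (intro B(5)) auto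
      then have "y \<inter> F = x \<inter> F" using z'(2) by blast
      then show "y \<in> V" using F(2) y(1) by (auto simp: cyl_def)
    qed
    \<comment> \<open>Nonemptiness: follow \<open>z\<close> in the first \<open>k\<close> blocks and
      avoid \<open>A (cut x)\<close> afterwards.\<close>
    obtain z' where z': "z' \<in> transversals" "\<And>i. i < k \<Longrightarrow> z' i = z i" "\<And>i. k \<le> i \<Longrightarrow> z' i \<notin> A (cut x)"
      using transversal_extend[OF B(3) An] by blast
    have z'n: "range z' \<inter> {..<n} = z' ` {..<k}" unfolding n_def by (rule range_below_power[OF z'(1)])
    have "z' ` {..<k} = z ` {..<k}" using z'(2) by (intro image_cong) auto
    then have eqn: "range z' \<inter> {..<n} = range z \<inter> {..<n}"
      using z'n range_below_power[OF B(3), of k] by (simp add: n_def)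
    have "range z' \<inter> D (q (cut x) n) = {}"
    proof -
      have "z' i \<notin> A (cut x) - {..<n}" for i
        using z'(3)[of i] z'n by (cases "i < k") auto
      then show ?thesis by (auto simp: D_q)
    qed
    then have "q (cut x) n \<in> principal_type gen z'" using z'(1) by (simp add: principal_type_def gen_def)
    moreover have "trace (principal_type gen z') = range z'"
      using z'(1) by (auto simp: trace_def principal_type_def gen_def D_p)
    ultimately have "principal_type gen z' \<in> U (range z \<inter> {..<n}) n"
      using principal_type_realized[OF z'(1)] eqn by (simp add: U_def)
    then have "U (range z \<inter> {..<n}) n \<in> \<P>" unfolding \<P>_def by blast
    then show "\<exists>U\<in>\<P>. U \<subseteq> V" using sub by blast
  qed
  ultimately show "\<exists>\<P>. countable \<P> \<and> pi_base_at K x \<P>" by blast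
qed

text \<open>A clopen set is measured by the probability that the principal type of a random
  transversal lies in it. For positivity on a cylinder, \<open>local_shape\<close> reduces to
  agreeing with one transversal in finitely many blocks and avoiding a set \<open>B\<close> of
  finite sum in the others, an event of positive probability.\<close>

lemma supports_measure_K: "supports_measure K"
proof -
  let ?P = "emeasure random_transversal"
  define \<Phi> where "\<Phi> V = {z \<in> transversals. principal_type gen z \<in> V}" for V
  have tr: "transversals \<in> sets random_transversal"
    unfolding transversals_def by (rule sets_components)
  have gen: "gen c \<in> sets random_transversal" for c
  proof -
    have "gen c = {z. \<forall>n. z n \<in> blk n - D c}" by (auto simp: gen_def transversals_def)
    then show ?thesis by (simp only: sets_components)
  qed
  have \<Phi>_cyl: "\<Phi> (cyl transversals gen F x) = {z \<in> transversals. \<forall>c\<in>F. c \<in> x \<longleftrightarrow> z \<in> gen c}" for F x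
    using principal_type_realized[of _ transversals gen]
    by (auto simp: \<Phi>_def cyl_def principal_type_def set_eq_iff)
  have meas_cyl: "\<Phi> (cyl transversals gen F x) \<in> sets random_transversal" if "finite F" for F x
  proof -
    have "{z \<in> transversals. \<forall>c\<in>F. c \<in> x \<longleftrightarrow> z \<in> gen c}
      = transversals \<inter> (\<Inter>c\<in>F. if c \<in> x then gen c else space random_transversal - gen c)"
      by (auto split: if_splits)
    also have "\<dots> \<in> sets random_transversal"
    proof (cases "F = {}")
      case True then show ?thesis using tr by simp
    next
      case False
      have "(if c \<in> x then gen c else space random_transversal - gen c) \<in> sets random_transversal" for c
        using gen[of c] sets.compl_sets[OF gen[of c]] by simp
      then show ?thesis using that False tr by (intro sets.Int sets.finite_INT) auto
    qed
    finally show ?thesis unfolding \<Phi>_cyl .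
  qed
  have meas: "\<Phi> V \<in> sets random_transversal" if V: "openin K V" "closedin K V" for V
  proof -
    \<comment> \<open>By compactness a clopen set is a finite union of cylinders, which makes its
      \<open>\<Phi>\<close> measurable.\<close>
    define \<B> where "\<B> = {C. C \<subseteq> V \<and> (\<exists>F x. finite F \<and> C = cyl transversals gen F x)}"
    have "compactin K V" using compact_type_space V(2) by (rule closedin_compact_space)
    moreover have "openin K C" if "C \<in> \<B>" for C using that by (auto simp: \<B>_def openin_cyl)
    moreover have "V \<subseteq> \<Union>\<B>"
    proof
      fix x assume x: "x \<in> V"
      then obtain F where F: "finite F" "cyl transversals gen F x \<subseteq> V" "x \<in> pts"
        using V(1) unfolding openin_type_space by blast
      then have "x \<in> cyl transversals gen F x" "cyl transversals gen F x \<in> \<B>" by (auto simp: cyl_def \<B>_def)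
      then show "x \<in> \<Union>\<B>" by blast
    qed
    ultimately obtain \<C> where C: "finite \<C>" "\<C> \<subseteq> \<B>" "V \<subseteq> \<Union>\<C>" using compactinD by metis
    then have "V = \<Union>\<C>" by (auto simp: \<B>_def)
    then have "\<Phi> V = (\<Union>C\<in>\<C>. \<Phi> C)" by (auto simp: \<Phi>_def)
    also have "\<dots> \<in> sets random_transversal"
      using C(1,2) meas_cyl by (intro sets.finite_UN) (auto simp: \<B>_def)
    finally show ?thesis .
  qed
  interpret prob_space random_transversal
    by (rule prob_space_PiM) (simp add: unif_blk_def prob_space_measure_pmf)
  obtain M where M: "radon_measure_on K M"
    "\<And>V. openin K V \<Longrightarrow> closedin K V \<Longrightarrow> emeasure M V = ?P (\<Phi> V)"
  proof (rule radon_extension[of K "\<lambda>V. ?P (\<Phi> V)"])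
    show "compact_space K" by (rule compact_type_space)
    show "\<exists>V. openin K V \<and> closedin K V \<and> x \<in> V \<and> V \<subseteq> U" if U: "openin K U" "x \<in> U" for U x
    proof -
      obtain F where F: "finite F" "cyl transversals gen F x \<subseteq> U" "x \<in> pts"
        using U unfolding openin_type_space by blast
      then show ?thesis
        by (intro exI[of _ "cyl transversals gen F x"]) (auto simp: openin_cyl closedin_cyl, auto simp: cyl_def)
    qed
    show "?P (\<Phi> {}) = 0" by (simp add: \<Phi>_def)
    show "?P (\<Phi> (V \<union> W)) = ?P (\<Phi> V) + ?P (\<Phi> W)"
      if "openin K V" "closedin K V" "openin K W" "closedin K W" "V \<inter> W = {}" for V W
      using that meas by (subst plus_emeasure) (auto simp: \<Phi>_def intro!: arg_cong[where f = ?P])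
    show "?P (\<Phi> (topspace K)) < \<infinity>" by (simp add: less_top[symmetric])
  qed blast
  have pos: "0 < ?P (\<Phi> (cyl transversals gen F x))" if x: "x \<in> pts" and F: "finite F" for F x
  proof -
    obtain B z m where B: "emeasure blk_sum B < \<infinity>" "z \<in> transversals" "range z \<inter> B = {}"
      "\<And>m' z'. m \<le> m' \<Longrightarrow> z' \<in> transversals \<Longrightarrow> range z' \<inter> {..<m'} = range z \<inter> {..<m'} \<Longrightarrow>
        range z' \<inter> (B - {..<m'}) = {} \<Longrightarrow> (\<forall>c\<in>F. c \<in> x \<longleftrightarrow> range z' \<inter> D c = {})"
      by (rule local_shape[OF x F]) blast
    obtain k where k: "k \<ge> m" "emeasure blk_sum (B - {..<k}) < 1"
      using emeasure_tail_less[OF sets_blk_sum B(1)] by (metis zero_less_one)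
    have mk: "m \<le> 2 ^ k" using k(1) less_exp[of k] by linarith
    have "emeasure blk_sum (B - {..<2^k}) \<le> emeasure blk_sum (B - {..<k})"
      by (intro emeasure_mono Diff_mono) auto
    then have Bk: "emeasure blk_sum (B - {..<2^k}) < 1" using k(2) by simp
    define W where "W = {y \<in> transversals. (\<forall>n<k. y n = z n) \<and> (\<forall>n\<ge>k. y n \<notin> B)}"
    have "0 < ?P W" unfolding W_def using B(2) Bk by (rule avoiding_transversals_pos)
    also have "?P W \<le> ?P (\<Phi> (cyl transversals gen F x))"
    proof (rule emeasure_mono)
      show "W \<subseteq> \<Phi> (cyl transversals gen F x)"
      proof
        fix y assume "y \<in> W"
        then have y: "y \<in> transversals" "\<And>n. n < k \<Longrightarrow> y n = z n" "\<And>n. n \<ge> k \<Longrightarrow> y n \<notin> B"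
          by (auto simp: W_def)
        have "y ` {..<k} = z ` {..<k}" using y(2) by (intro image_cong) auto
        then have "range y \<inter> {..<2^k} = range z \<inter> {..<2^k}"
          using range_below_power y(1) B(2) by simp
        moreover have "y n \<notin> B" for n using y(2)[of n] y(3)[of n] B(3) by (cases "n < k") auto
        ultimately have "\<forall>c\<in>F. c \<in> x \<longleftrightarrow> range y \<inter> D c = {}"
          by (intro B(4)[OF mk y(1)]) auto
        then show "y \<in> \<Phi> (cyl transversals gen F x)" unfolding \<Phi>_cyl using y(1) by (auto simp: gen_def)
      qed
    qed (rule meas_cyl[OF F])
    finally show ?thesis .
  qed
  have "0 < emeasure M U" if U: "openin K U" "U \<noteq> {}" for U
  proof -
    obtain x where x: "x \<in> U" using U(2) by blast
    then obtain F where F: "finite F" "cyl transversals gen F x \<subseteq> U" "x \<in> pts"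
      using U(1) unfolding openin_type_space by blast
    have "0 < emeasure M (cyl transversals gen F x)"
      using pos[OF F(3,1)] M(2) F(1) by (simp add: openin_cyl closedin_cyl)
    also have "\<dots> \<le> emeasure M U"
      using M(1) U(1) F(2) by (intro emeasure_mono) (auto simp: radon_measure_on_def)
    finally show ?thesis .
  qed
  then show ?thesis using M(1) unfolding supports_measure_def by blast
qed

end

section \<open>The space under Martin's Axiom\<close>

theorem theorem3p3:
  assumes "MA"
  shows "\<exists>K :: (nat \<Rightarrow> bool) set set topology.
    compact_space K \<and> Hausdorff_space K \<and> \<not> separable_space K \<and>
    supports_measure K \<and>
    (\<exists>f. continuous_map K cantor_space f \<and>
         (\<forall>t\<in>topspace cantor_space.
            homeomorphic_to_ordinal (subtopology K {x \<in> topspace K. f x = t}))) \<and>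
    \<not> (\<exists>g. continuous_map K tikhonov_cube_omega1 g \<and>
           g ` topspace K = topspace tikhonov_cube_omega1) \<and>
    countable_pi_character K"
proof -
  define r where "r = card_of (UNIV :: (nat \<Rightarrow> bool) set)"
  have wo: "Well_order r" and Fr: "Field r = UNIV"
    unfolding r_def by (rule card_of_Well_order, rule Field_card_of)
  obtain A :: "(nat \<Rightarrow> bool) \<Rightarrow> nat set" where A: "\<And>a. emeasure blk_sum (A a) < \<infinity>"
    "\<And>a b. (b, a) \<in> r \<Longrightarrow> finite (A b - A a)"
    "\<And>B. emeasure blk_sum B < \<infinity> \<Longrightarrow> \<exists>a. B \<subseteq> A a"
    using MA_almost_chain[OF assms sets_blk_sum r_def] by blast
  define \<T> where "\<T> = range (\<lambda>i. {i}) \<union> {A a - {..<m} | a m. True}"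
  \<comment> \<open>Indices of this type give points of the required type. \<open>dec\<close> takes
    the union of the sets coded by the members of an index, and \<open>p\<close> and
    \<open>q\<close> use one-element indices. An index that codes no generator falls back on
    \<open>{0}\<close>, which every transversal avoids.\<close>
  define dec where "dec c = {n. \<exists>b\<in>c. b n}" for c :: "(nat \<Rightarrow> bool) set"
  define D where "D c = (if dec c \<in> \<T> then dec c else {0})" for c
  define p :: "nat \<Rightarrow> (nat \<Rightarrow> bool) set" where "p i = {\<lambda>n. n = i}" for i
  define q where "q a m = {\<lambda>n. n \<in> A a - {..<m}}" for a m
  have D_p: "D (p i) = {i}" for i by (auto simp: D_def dec_def p_def \<T>_def)
  have D_q: "D (q a m) = A a - {..<m}" for a m
  proof -
    have "dec (q a m) = A a - {..<m}" by (auto simp: dec_def q_def)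
    moreover have "A a - {..<m} \<in> \<T>" by (auto simp: \<T>_def)
    ultimately show ?thesis by (simp add: D_def)
  qed
  have D_cases: "(\<exists>i. D c = {i}) \<or> (\<exists>a m. D c = A a - {..<m})" for c
    unfolding D_def \<T>_def by auto
  interpret slalom_chain r A D p q
    by unfold_locales (rule wo, rule Fr, rule A, erule A, erule A, rule D_p, rule D_q, rule D_cases)
  have ub: "\<exists>C. emeasure blk_sum C < \<infinity> \<and> (\<forall>B\<in>\<F>. finite (B - C))"
    if F: "countable \<F>" "\<And>B. B \<in> \<F> \<Longrightarrow> emeasure blk_sum B < \<infinity>" for \<F>
  proof (rule MA_almost_upper_bound[OF assms sets_blk_sum _ F(2)])
    have "\<F> \<lesssim> (UNIV :: nat set)" using F(1) by (auto simp: countable_def lepoll_def)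
    also have "(UNIV :: nat set) \<prec> Pow (UNIV :: nat set)" by (rule lesspoll_Pow_self)
    also have "Pow (UNIV :: nat set) \<approx> (UNIV :: (nat \<Rightarrow> bool) set)"
      unfolding eqpoll_def by (intro exI[of _ "\<lambda>S n. n \<in> S"] bij_betwI[of _ _ _ Collect]) auto
    finally show "\<F> \<prec> (UNIV :: (nat \<Rightarrow> bool) set)" .
  qed
  let ?f = "\<lambda>x i. i \<in> trace x"
  \<comment> \<open>A map onto the cube would have a coordinate whose values on some fiber cover
    \<open>[0,1]\<close>, but the fibers are compact ordinals.\<close>
  have no_surj: False if g: "continuous_map K tikhonov_cube_omega1 g"
    "g ` topspace K = topspace tikhonov_cube_omega1" for g
  proof -
    obtain t h where h: "continuous_map (subtopology K {x \<in> topspace K. ?f x = t}) euclideanreal h"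
      "{0..1} \<subseteq> h ` {x \<in> topspace K. ?f x = t}"
      using fiber_onto_interval[OF compact_type_space continuous_trace g] .
    have "topspace (subtopology K {x \<in> topspace K. ?f x = t}) = {x \<in> topspace K. ?f x = t}" by auto
    then show False
      using ordinal_no_map_onto_interval[OF fiber_homeomorphic_to_ordinal compact_fiber h(1)] h(2)
      by (simp only: not_True_eq_False)
  qed
  show ?thesis
  proof (intro exI[of _ K] conjI exI[of _ ?f] ballI notI)
    show "compact_space K" by (rule compact_type_space)
    show "Hausdorff_space K" by (rule Hausdorff_type_space)
    show "False" if "separable_space K" using not_separable[OF ub] that by blast
    show "supports_measure K" by (rule supports_measure_K)
    show "continuous_map K cantor_space ?f" by (rule continuous_trace)
    show "homeomorphic_to_ordinal (subtopology K {x \<in> topspace K. ?f x = t})" for t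
      by (rule fiber_homeomorphic_to_ordinal)
    show False if "\<exists>g. continuous_map K tikhonov_cube_omega1 g \<and>
        g ` topspace K = topspace tikhonov_cube_omega1"
      using that no_surj by blast
    show "countable_pi_character K" by (rule countable_pi_character_K)
  qed
qed

end
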